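(* Let $(\Gamma,\mathcal G)$ be a boundary pair associated with $\mathfrak h$. Then the following assertions are equivalent (where in each of (ii)–(iv) the "for some" and the "for any" version may be used, and in (v) either of the two versions, all resulting assertions being equivalent): (i) The boundary pair is elliptically regular. (ii) For some (any) $z\in\mathbb C\setminus\sigma(H^D)$ the solution form $\mathfrak q_z(\phi):=\|S(z)\phi\|_{\mathcal H}^2$, $\phi\in\mathcal G^{1/2}$, extends to a bounded form on $\mathcal G$, associated with a bounded operator $Q(z)$ on $\mathcal G$. (iii) For some (any) $z\in\mathbb C\setminus\mathbb R$ the imaginary part $\operatorname{Im}\mathfrak l_z=\frac1{2\mathrm i}(\mathfrak l_z-\mathfrak l_z^* )\,(=-(\operatorname{Im}z)\mathfrak q_z)$ of the Dirichlet-to-Neumann form is bounded with respect to the norm of $\mathcal G$, and hence associated with a bounded operator $-(\operatorname{Im} z)Q(z)$ on $\mathcal G$. (iv) For some (any) $\lambda\in\mathbb R\setminus\sigma(H^D)$ the derivative $\mathfrak l_\lambda'$ (with respect to $\lambda$) of the Dirichlet-to-Neumann form is bounded with respect to the norm of $\mathcal G$, and hence associated with a bounded operator on $\mathcal G$ (given by $\Lambda'(\lambda):=-Q(\lambda)$). (v) For $z\in\mathbb R$ in a neighbourhood of $-1$ (respectively, for all $z\in\mathbb C\setminus\sigma(H^D)$) there exists $\omega(z)\in\mathbb R$ such that $\omega(-1)=0$, $\limsup_{a\to-1}\frac{\omega(a)}{a+1}$ is finite ($a$ real), and $\mathfrak l_z$ is elliptic in $\mathcal G$ with constants $\alpha=1$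 and $\omega(z)$, i.e. $(\operatorname{Re}\mathfrak l_z)(\phi)+\omega(z)\|\phi\|_{\mathcal G}^2\ge\|\phi\|_{\mathcal G^{1/2}}^2$ for all $\phi\in\mathcal G^{1/2}$. (vi) $\Gamma(\operatorname{dom}H)\subset\mathcal G^1:=\operatorname{dom}\Lambda$. (vii) The operator $\Lambda\Gamma R$, $R:=(H+1)^{-1}$, maps $\mathcal H$ into $\mathcal G$ and is bounded as an operator $\mathcal H\to\mathcal G$.
   Context: All Hilbert spaces are complex; inner products and sesquilinear forms are linear in the first argument. Let $\mathfrak h$ be a closed, non-negative, densely defined quadratic form in a Hilbert space $\mathcal H$ (the same symbol denotes its sesquilinear form), with domain $\mathcal H^1:=\operatorname{dom}\mathfrak h$, a Hilbert space with norm $\|u\|_{\mathcal H^1}^2=\mathfrak h(u)+\|u\|_{\mathcal H}^2$. A boundary pair associated with $\mathfrak h$ is a pair $(\Gamma,\mathcal G)$ of a Hilbert space $\mathcal G$ and a bounded operator $\Gamma\colon\mathcal H^1\to\mathcal G$ such that $\mathcal H^{1,D}:=\ker\Gamma$ is dense in $\mathcal H$ and $\mathcal G^{1/2}:=\operatorname{ran}\Gamma$ is dense in $\mathcal G$. The Neumann operator $H$ is the self-adjoint operator associated with $\mathfrak h$; the Dirichlet operator $H^D$ is the self-adjoint operator associated with the closed form $\mathfrak h|_{\mathcal H^{1,D}}$. For $z\in\mathbb C$ let $\mathcal N^1(z):=\{h\in\mathcal H^1: \mathfrak h(h,f)=z\langle h,f\rangle_{\mathcal H}\ \forall f\in\mathcal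 H^{1,D}\}$. For $z\notin\sigma(H^D)$, $\Gamma$ restricts to a bijection $\mathcal N^1(z)\to\mathcal G^{1/2}$, whose inverse is $S(z)\colon\mathcal G^{1/2}\to\mathcal N^1(z)\subset\mathcal H^1$; $S:=S(-1)$. The space $\mathcal G^{1/2}$ is a Hilbert space with norm $\|\phi\|_{\mathcal G^{1/2}}:=\|S\phi\|_{\mathcal H^1}$. The Dirichlet-to-Neumann form is $\mathfrak l_z(\phi,\psi):=\mathfrak h(S(z)\phi,S\psi)-z\langle S(z)\phi,S\psi\rangle_{\mathcal H}$, $\phi,\psi\in\mathcal G^{1/2}$; it depends holomorphically on $z\in\mathbb C\setminus\sigma(H^D)$. $\Lambda$ is the self-adjoint operator in $\mathcal G$ associated with the closed form $\mathfrak l_{-1}(\phi)=\|S\phi\|_{\mathcal H^1}^2$, $\operatorname{dom}\mathfrak l_{-1}=\mathcal G^{1/2}$. For a form $\mathfrak a$: $\mathfrak a^*(\phi,\psi)=\overline{\mathfrak a(\psi,\phi)}$, $\operatorname{Re}\mathfrak a=\frac12(\mathfrak a+\mathfrak a^* )$, $\mathfrak a(\phi)=\mathfrak a(\phi,\phi)$. The boundary pair is elliptically regular if there is $C>0$ such that $\|S\phi\|_{\mathcal H}^2\le C^2\|\phi\|_{\mathcal G}^2$ for all $\phi\in\mathcal G^{1/2}$. *)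

theory Defs
  imports "HOL-Analysis.Analysis"
begin

section \<open>Complex Hilbert spaces\<close>

text \<open>
  The complex inner product is linear in the first argument. The last axiom ties it to the real
  inner product of the underlying real Hilbert space (hence also to the norm).
\<close>

class complex_hilbert_space = real_inner + complete_space +
  fixes scaleC :: "complex \<Rightarrow> 'a \<Rightarrow> 'a"  (infixr "*\<^sub>C" 75)
    and cinner :: "'a \<Rightarrow> 'a \<Rightarrow> complex"
  assumes scaleR_scaleC: "scaleR r x = complex_of_real r *\<^sub>C x"
    and scaleC_add_right: "a *\<^sub>C (x + y) = a *\<^sub>C x + a *\<^sub>C y"
    and scaleC_add_left: "(a + b) *\<^sub>C x = a *\<^sub>C x + b *\<^sub>C x"
    and scaleC_scaleC: "a *\<^sub>C (b *\<^sub>C x) = (a * b) *\<^sub>C x"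
    and scaleC_one: "1 *\<^sub>C x = x"
    and cinner_commute: "cinner x y = cnj (cinner y x)"
    and cinner_add_left: "cinner (x + y) z = cinner x z + cinner y z"
    and cinner_scaleC_left: "cinner (a *\<^sub>C x) y = a * cinner x y"
    and inner_eq_Re_cinner: "inner x y = Re (cinner x y)"

instance complex_hilbert_space \<subseteq> banach ..

instantiation complex :: complex_hilbert_space
begin

definition scaleC_complex :: "complex \<Rightarrow> complex \<Rightarrow> complex"
  where "scaleC_complex a x = a * x"

definition cinner_complex :: "complex \<Rightarrow> complex \<Rightarrow> complex"
  where "cinner_complex x y = x * cnj y"

instance
  by standard (simp_all add: scaleC_complex_def cinner_complex_def algebra_simps
      scaleR_conv_of_real inner_complex_def)

end

definition csubspace :: "'a::complex_hilbert_space set \<Rightarrow> bool"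
  where "csubspace V \<longleftrightarrow>
    0 \<in> V \<and> (\<forall>x\<in>V. \<forall>y\<in>V. x + y \<in> V) \<and> (\<forall>c. \<forall>x\<in>V. c *\<^sub>C x \<in> V)"

definition clinear_on ::
    "'a::complex_hilbert_space set \<Rightarrow> ('a \<Rightarrow> 'b::complex_hilbert_space) \<Rightarrow> bool"
  where "clinear_on V T \<longleftrightarrow>
    (\<forall>x\<in>V. \<forall>y\<in>V. T (x + y) = T x + T y) \<and> (\<forall>c. \<forall>x\<in>V. T (c *\<^sub>C x) = c *\<^sub>C T x)"

definition bounded_op :: "('a::complex_hilbert_space \<Rightarrow> 'b::complex_hilbert_space) \<Rightarrow> bool"
  where "bounded_op T \<longleftrightarrow> clinear_on UNIV T \<and> (\<exists>C. \<forall>x. norm (T x) \<le> C * norm x)"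

section \<open>Partially defined operators and their spectrum\<close>

text \<open>An unbounded operator is given by its domain \<open>V\<close> and a function, used on \<open>V\<close> only.\<close>

definition resolvent_set ::
    "'a::complex_hilbert_space set \<Rightarrow> ('a \<Rightarrow> 'a) \<Rightarrow> complex set"
  where "resolvent_set V A =
    {z. bij_betw (\<lambda>u. A u - z *\<^sub>C u) V UNIV \<and>
        (\<exists>C. \<forall>u\<in>V. norm u \<le> C * norm (A u - z *\<^sub>C u))}"

definition spectrum :: "'a::complex_hilbert_space set \<Rightarrow> ('a \<Rightarrow> 'a) \<Rightarrow> complex set"
  where "spectrum V A = - resolvent_set V A"

section \<open>Sesquilinear forms\<close>

text \<open>
  A quadratic form is given by its domain and its sesquilinear form, used on the domain only;
  its value at \<open>u\<close> is \<open>a u u\<close>.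
\<close>

type_synonym 'a form = "'a \<Rightarrow> 'a \<Rightarrow> complex"

definition sesquilinear_on :: "'a::complex_hilbert_space set \<Rightarrow> 'a form \<Rightarrow> bool"
  where "sesquilinear_on V a \<longleftrightarrow>
    (\<forall>x\<in>V. \<forall>y\<in>V. \<forall>v\<in>V. a (x + y) v = a x v + a y v \<and> a v (x + y) = a v x + a v y) \<and>
    (\<forall>c. \<forall>x\<in>V. \<forall>v\<in>V. a (c *\<^sub>C x) v = c * a x v \<and> a v (c *\<^sub>C x) = cnj c * a v x)"

definition adjoint_form :: "'a form \<Rightarrow> 'a form"
  where "adjoint_form a x y = cnj (a y x)"

definition Re_form :: "'a form \<Rightarrow> 'a form"
  where "Re_form a x y = (a x y + adjoint_form a x y) / 2"

definition Im_form :: "'a form \<Rightarrow> 'a form"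
  where "Im_form a x y = (a x y - adjoint_form a x y) / (2 * \<i>)"

definition form_bounded_on :: "'a::complex_hilbert_space set \<Rightarrow> 'a form \<Rightarrow> bool"
  where "form_bounded_on V a \<longleftrightarrow> (\<exists>C. \<forall>x\<in>V. cmod (a x x) \<le> C * (norm x)\<^sup>2)"

definition form_assoc_bounded_op ::
    "'a::complex_hilbert_space set \<Rightarrow> 'a form \<Rightarrow> ('a \<Rightarrow> 'a) \<Rightarrow> bool"
  where "form_assoc_bounded_op V a T \<longleftrightarrow>
    bounded_op T \<and> (\<forall>x\<in>V. \<forall>y\<in>V. a x y = cinner (T x) y)"

text \<open>
  In \<open>form_elliptic V N a \<alpha> \<omega>\<close>, \<open>N\<close> is the norm of the form domain \<open>V\<close>. The diagonal values of
  \<open>Re_form a\<close> are real, so the outer \<open>Re\<close> is only a coercion to the reals.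
\<close>

definition form_elliptic ::
    "'a::complex_hilbert_space set \<Rightarrow> ('a \<Rightarrow> real) \<Rightarrow> 'a form \<Rightarrow> real \<Rightarrow> real \<Rightarrow> bool"
  where "form_elliptic V N a \<alpha> \<omega> \<longleftrightarrow>
    (\<forall>x\<in>V. Re (Re_form a x x) + \<omega> * (norm x)\<^sup>2 \<ge> \<alpha> * (N x)\<^sup>2)"

definition form_norm :: "'a::complex_hilbert_space form \<Rightarrow> 'a \<Rightarrow> real"
  where "form_norm a u = sqrt (Re (a u u) + (norm u)\<^sup>2)"

text \<open>Closedness of the form is completeness of its domain in the form norm.\<close>

definition closed_nonneg_form :: "'a::complex_hilbert_space set \<Rightarrow> 'a form \<Rightarrow> bool"
  where "closed_nonneg_form V a \<longleftrightarrow>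
    csubspace V \<and> closure V = UNIV \<and> sesquilinear_on V a \<and>
    (\<forall>u\<in>V. a u u \<in> \<real>\<^sub>\<ge>\<^sub>0) \<and>
    (\<forall>u::nat \<Rightarrow> 'a. (\<forall>n. u n \<in> V) \<longrightarrow>
      (\<forall>e>0. \<exists>N. \<forall>m\<ge>N. \<forall>n\<ge>N. form_norm a (u m - u n) < e) \<longrightarrow>
      (\<exists>l\<in>V. (\<lambda>n. form_norm a (u n - l)) \<longlonglongrightarrow> 0))"

text \<open>
  The operator associated with a form: \<open>u\<close> is in its domain iff \<open>a u\<close> is represented on \<open>V\<close> by
  some vector, which is unique when \<open>V\<close> is dense and is then the value at \<open>u\<close>.
\<close>

definition form_op_dom :: "'a::complex_hilbert_space set \<Rightarrow> 'a form \<Rightarrow> 'a set"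
  where "form_op_dom V a = {u \<in> V. \<exists>w. \<forall>v\<in>V. a u v = cinner w v}"

definition form_op :: "'a::complex_hilbert_space set \<Rightarrow> 'a form \<Rightarrow> 'a \<Rightarrow> 'a"
  where "form_op V a u = (THE w. \<forall>v\<in>V. a u v = cinner w v)"

section \<open>Boundary pairs\<close>

text \<open>
  Throughout, \<open>D\<close> is the domain of the form \<open>h\<close>, with the norm \<open>form_norm h\<close>, and \<open>\<Gamma>\<close> is the
  boundary map, used on \<open>D\<close> only.
\<close>

definition dirichlet_dom ::
    "'h::complex_hilbert_space set \<Rightarrow> ('h \<Rightarrow> 'g::complex_hilbert_space) \<Rightarrow> 'h set"
  where "dirichlet_dom D \<Gamma> = {u \<in> D. \<Gamma> u = 0}"

definition boundary_pair ::
    "'h::complex_hilbert_space set \<Rightarrow> 'h form \<Rightarrow> ('h \<Rightarrow> 'g::complex_hilbert_space) \<Rightarrow> bool"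
  where "boundary_pair D h \<Gamma> \<longleftrightarrow>
    clinear_on D \<Gamma> \<and> (\<exists>C. \<forall>u\<in>D. norm (\<Gamma> u) \<le> C * form_norm h u) \<and>
    closure (dirichlet_dom D \<Gamma>) = UNIV \<and> closure (\<Gamma> ` D) = UNIV"

definition neumann_dom :: "'h::complex_hilbert_space set \<Rightarrow> 'h form \<Rightarrow> 'h set"
  where "neumann_dom D h = form_op_dom D h"

definition neumann_op :: "'h::complex_hilbert_space set \<Rightarrow> 'h form \<Rightarrow> 'h \<Rightarrow> 'h"
  where "neumann_op D h = form_op D h"

definition neumann_resolvent :: "'h::complex_hilbert_space set \<Rightarrow> 'h form \<Rightarrow> 'h \<Rightarrow> 'h"
  where "neumann_resolvent D h = inv_into (neumann_dom D h) (\<lambda>u. neumann_op D h u + u)"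

definition dirichlet_spectrum ::
    "'h::complex_hilbert_space set \<Rightarrow> 'h form \<Rightarrow> ('h \<Rightarrow> 'g::complex_hilbert_space) \<Rightarrow> complex set"
  where "dirichlet_spectrum D h \<Gamma> =
    spectrum (form_op_dom (dirichlet_dom D \<Gamma>) h) (form_op (dirichlet_dom D \<Gamma>) h)"

definition weak_solutions ::
    "'h::complex_hilbert_space set \<Rightarrow> 'h form \<Rightarrow> ('h \<Rightarrow> 'g::complex_hilbert_space) \<Rightarrow>
     complex \<Rightarrow> 'h set"
  where "weak_solutions D h \<Gamma> z =
    {u \<in> D. \<forall>f\<in>dirichlet_dom D \<Gamma>. h u f = z * cinner u f}"

text \<open>The solution operator \<open>S(z)\<close>; meaningful on \<open>\<Gamma> ` D\<close>, for \<open>z\<close> outside the Dirichlet spectrum.\<close>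

definition solution_map ::
    "'h::complex_hilbert_space set \<Rightarrow> 'h form \<Rightarrow> ('h \<Rightarrow> 'g::complex_hilbert_space) \<Rightarrow>
     complex \<Rightarrow> 'g \<Rightarrow> 'h"
  where "solution_map D h \<Gamma> z = inv_into (weak_solutions D h \<Gamma> z) \<Gamma>"

definition boundary_norm ::
    "'h::complex_hilbert_space set \<Rightarrow> 'h form \<Rightarrow> ('h \<Rightarrow> 'g::complex_hilbert_space) \<Rightarrow>
     'g \<Rightarrow> real"
  where "boundary_norm D h \<Gamma> \<phi> = form_norm h (solution_map D h \<Gamma> (-1) \<phi>)"

definition elliptically_regular ::
    "'h::complex_hilbert_space set \<Rightarrow> 'h form \<Rightarrow> ('h \<Rightarrow> 'g::complex_hilbert_space) \<Rightarrow> bool"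
  where "elliptically_regular D h \<Gamma> \<longleftrightarrow>
    (\<exists>C>0. \<forall>\<phi>\<in>\<Gamma> ` D. (norm (solution_map D h \<Gamma> (-1) \<phi>))\<^sup>2 \<le> C\<^sup>2 * (norm \<phi>)\<^sup>2)"

definition dtn_form ::
    "'h::complex_hilbert_space set \<Rightarrow> 'h form \<Rightarrow> ('h \<Rightarrow> 'g::complex_hilbert_space) \<Rightarrow>
     complex \<Rightarrow> 'g form"
  where "dtn_form D h \<Gamma> z \<phi> \<psi> =
    h (solution_map D h \<Gamma> z \<phi>) (solution_map D h \<Gamma> (-1) \<psi>) -
    z * cinner (solution_map D h \<Gamma> z \<phi>) (solution_map D h \<Gamma> (-1) \<psi>)"

text \<open>
  The derivative of the Dirichlet-to-Neumann form at a real point. The form is holomorphic in the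
  parameter off the Dirichlet spectrum, so the complex derivative is also the real one.
\<close>

definition dtn_form_deriv ::
    "'h::complex_hilbert_space set \<Rightarrow> 'h form \<Rightarrow> ('h \<Rightarrow> 'g::complex_hilbert_space) \<Rightarrow>
     real \<Rightarrow> 'g form"
  where "dtn_form_deriv D h \<Gamma> r \<phi> \<psi> =
    deriv (\<lambda>z. dtn_form D h \<Gamma> z \<phi> \<psi>) (complex_of_real r)"

text \<open>The quadratic form of \<open>solution_form\<close> is \<open>\<phi> \<mapsto> \<parallel>S(z) \<phi>\<parallel>\<^sup>2\<close>.\<close>

definition solution_form ::
    "'h::complex_hilbert_space set \<Rightarrow> 'h form \<Rightarrow> ('h \<Rightarrow> 'g::complex_hilbert_space) \<Rightarrow>
     complex \<Rightarrow> 'g form"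
  where "solution_form D h \<Gamma> z \<phi> \<psi> =
    cinner (solution_map D h \<Gamma> z \<phi>) (solution_map D h \<Gamma> z \<psi>)"

text \<open>
  The operator \<open>Q(z)\<close>. It is unique if it exists, since \<open>\<Gamma> ` D\<close> is dense; where it is used
  below, its existence is part of what is asserted.
\<close>

definition solution_form_op ::
    "'h::complex_hilbert_space set \<Rightarrow> 'h form \<Rightarrow> ('h \<Rightarrow> 'g::complex_hilbert_space) \<Rightarrow>
     complex \<Rightarrow> 'g \<Rightarrow> 'g"
  where "solution_form_op D h \<Gamma> z =
    (THE Q. form_assoc_bounded_op (\<Gamma> ` D) (solution_form D h \<Gamma> z) Q)"

definition solution_form_extends ::
    "'h::complex_hilbert_space set \<Rightarrow> 'h form \<Rightarrow> ('h \<Rightarrow> 'g::complex_hilbert_space) \<Rightarrow>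
     complex \<Rightarrow> bool"
  where "solution_form_extends D h \<Gamma> z \<longleftrightarrow>
    (\<exists>q. sesquilinear_on UNIV q \<and> form_bounded_on UNIV q \<and>
         (\<forall>\<phi>\<in>\<Gamma> ` D. \<forall>\<psi>\<in>\<Gamma> ` D. q \<phi> \<psi> = solution_form D h \<Gamma> z \<phi> \<psi>) \<and>
         form_assoc_bounded_op UNIV q (solution_form_op D h \<Gamma> z))"

text \<open>
  The operator \<open>\<Lambda>\<close>. At \<open>z = -1\<close> the Dirichlet-to-Neumann form has the quadratic form
  \<open>\<phi> \<mapsto> (boundary_norm D h \<Gamma> \<phi>)\<^sup>2\<close>.
\<close>

definition dtn_op_dom ::
    "'h::complex_hilbert_space set \<Rightarrow> 'h form \<Rightarrow> ('h \<Rightarrow> 'g::complex_hilbert_space) \<Rightarrow> 'g set"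
  where "dtn_op_dom D h \<Gamma> = form_op_dom (\<Gamma> ` D) (dtn_form D h \<Gamma> (-1))"

definition dtn_op ::
    "'h::complex_hilbert_space set \<Rightarrow> 'h form \<Rightarrow> ('h \<Rightarrow> 'g::complex_hilbert_space) \<Rightarrow> 'g \<Rightarrow> 'g"
  where "dtn_op D h \<Gamma> = form_op (\<Gamma> ` D) (dtn_form D h \<Gamma> (-1))"

definition ellipticity_rate :: "(real \<Rightarrow> real) \<Rightarrow> bool"
  where "ellipticity_rate \<omega> \<longleftrightarrow>
    \<omega> (-1) = 0 \<and> \<bar>Limsup (at (-1)) (\<lambda>a. ereal (\<omega> a / (a + 1)))\<bar> \<noteq> \<infinity>"

end

theory Submission
  imports Defs
begin

text \<open>
  Two identities for the solution operators carry the equivalences. First,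
  \<open>S(z) - S(w) = (z - w) R\<^sup>D(z) S(w)\<close>, where \<open>R\<^sup>D(z)\<close> is the Dirichlet resolvent, so that boundedness
  of \<open>S(z)\<close> in the norm of \<open>\<G>\<close> does not depend on \<open>z\<close>. Second,
  \<open>l\<^sub>z(\<phi>, \<psi>) - cnj (l\<^sub>w(\<psi>, \<phi>)) = (cnj w - z) \<langle>S(z) \<phi>, S(w) \<psi>\<rangle>\<close>, which yields the imaginary part
  (\<open>w = z\<close>), the derivative (\<open>w\<close> real, \<open>z\<close> near \<open>w\<close>) and the ellipticity estimate (\<open>w = -1\<close>).
  Finally \<open>\<Lambda> \<Gamma> R = S\<^sup>*\<close>, so the last two conditions amount to \<open>S\<^sup>*\<close> being everywhere defined,
  which is equivalent to boundedness of \<open>S\<close> by the uniform boundedness principle.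
\<close>

section \<open>Complex inner products and sesquilinear forms\<close>

text \<open>A form domain is complete only in its form norm, and the trace range \<open>G\<close> is
  merely dense in the boundary space. Riesz representation is therefore set up for semidefinite
  forms on possibly incomplete spaces: minimizing an energy gives a Cauchy sequence that represents
  the functional in the limit, and each application supplies its own completeness. Resolvents enter
  as a relation between \<open>u\<close> and \<open>w\<close>, the weak form of
  \<open>(A - z) u = w\<close>. It can be manipulated before \<open>z\<close> is known to lie in the
  resolvent set, and membership becomes solvability plus an a priori bound. Before regularity is
  known, \<open>S(z)\<close> cannot be measured against the norm of the boundary space. All
  comparisons are therefore relative: the difference of \<open>S(z)\<close> and \<open>S(w)\<close>
  at a boundary value is bounded by a multiple of the norm of \<open>S(w)\<close> there. This
  relative closeness also lets ellipticity control \<open>S(-1)\<close> in the converse direction of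
  (v).\<close>

lemma scaleC_zero_left [simp]: "0 *\<^sub>C x = (0::'a::complex_hilbert_space)"
  using scaleC_add_left[of 0 0 x] by simp

lemma scaleC_zero_right [simp]: "c *\<^sub>C (0::'a::complex_hilbert_space) = 0"
  using scaleC_add_right[of c 0 0] by simp

lemma scaleC_minus_left: "(- c) *\<^sub>C x = - (c *\<^sub>C (x::'a::complex_hilbert_space))"
  using scaleC_add_left[of "- c" c x] by (simp add: eq_neg_iff_add_eq_0)

lemma scaleC_minus_one: "(- 1) *\<^sub>C x = - (x::'a::complex_hilbert_space)"
  by (simp add: scaleC_minus_left scaleC_one)

lemma scaleC_minus_right: "c *\<^sub>C (- x) = - (c *\<^sub>C (x::'a::complex_hilbert_space))"
  using scaleC_add_right[of c "- x" x] by (simp add: eq_neg_iff_add_eq_0)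

lemma scaleC_diff_right: "c *\<^sub>C (x - y) = c *\<^sub>C x - c *\<^sub>C (y::'a::complex_hilbert_space)"
  using scaleC_add_right[of c x "- y"] by (simp add: scaleC_minus_right)

lemma csubspace_diff:
  assumes "csubspace V" "x \<in> V" "y \<in> V"
  shows "x - y \<in> V"
proof -
  have "x + (- 1) *\<^sub>C y \<in> V" using assms unfolding csubspace_def by blast
  then show ?thesis by (simp add: scaleC_minus_one)
qed

lemma csubspaceD:
  assumes "csubspace V"
  shows "0 \<in> V" "x \<in> V \<Longrightarrow> y \<in> V \<Longrightarrow> x + y \<in> V" "x \<in> V \<Longrightarrow> c *\<^sub>C x \<in> V"
  using assms unfolding csubspace_def by blast+

lemma csubspace_UNIV: "csubspace UNIV"
  by (simp add: csubspace_def)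

lemma clinear_onD:
  assumes "clinear_on V T"
  shows "x \<in> V \<Longrightarrow> y \<in> V \<Longrightarrow> T (x + y) = T x + T y" "x \<in> V \<Longrightarrow> T (c *\<^sub>C x) = c *\<^sub>C T x"
  using assms unfolding clinear_on_def by blast+

lemma clinear_on_diff:
  assumes "clinear_on V T" "csubspace V" "x \<in> V" "y \<in> V"
  shows "T (x - y) = T x - T y"
proof -
  have "T (x + (- 1) *\<^sub>C y) = T x + (- 1) *\<^sub>C T y"
    using assms by (simp add: clinear_onD csubspaceD)
  then show ?thesis by (simp add: scaleC_minus_one)
qed

lemma sesquilinear_onD:
  assumes "sesquilinear_on V a" "v \<in> V"
  shows "x \<in> V \<Longrightarrow> y \<in> V \<Longrightarrow> a (x + y) v = a x v + a y v"
    "x \<in> V \<Longrightarrow> y \<in> V \<Longrightarrow> a v (x + y) = a v x + a v y"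
    "x \<in> V \<Longrightarrow> a (c *\<^sub>C x) v = c * a x v"
    "x \<in> V \<Longrightarrow> a v (c *\<^sub>C x) = cnj c * a v x"
  using assms unfolding sesquilinear_on_def by blast+

lemma sesquilinear_on_diff:
  assumes "sesquilinear_on V a" "csubspace V" "v \<in> V" "x \<in> V" "y \<in> V"
  shows "a (x - y) v = a x v - a y v" "a v (x - y) = a v x - a v y"
proof -
  have "a (x + (- 1) *\<^sub>C y) v = a x v - a y v" "a v (x + (- 1) *\<^sub>C y) = a v x - a v y"
    using assms by (simp_all add: sesquilinear_onD csubspaceD)
  then show "a (x - y) v = a x v - a y v" "a v (x - y) = a v x - a v y"
    by (simp_all add: scaleC_minus_one)
qed

lemma cinner_add_right: "cinner x (y + z) = cinner x y + cinner x z"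
  unfolding cinner_commute[of x "y + z"] cinner_commute[of x y] cinner_commute[of x z]
  by (simp add: cinner_add_left)

lemma cinner_scaleC_right: "cinner x (c *\<^sub>C y) = cnj c * cinner x y"
  unfolding cinner_commute[of x "c *\<^sub>C y"] cinner_commute[of x y]
  by (simp add: cinner_scaleC_left)

lemma sesquilinear_on_cinner: "sesquilinear_on V cinner"
  by (simp add: sesquilinear_on_def cinner_add_left cinner_add_right cinner_scaleC_left
      cinner_scaleC_right)

lemma cinner_diff_left: "cinner (x - y) z = cinner x z - cinner y z"
  and cinner_diff_right: "cinner z (x - y) = cinner z x - cinner z y"
  using sesquilinear_on_diff[OF sesquilinear_on_cinner csubspace_UNIV] by simp_all

lemma cinner_zero_left [simp]: "cinner 0 x = 0"
  using cinner_diff_left[of 0 0 x] by simp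

lemma cinner_zero_right [simp]: "cinner x 0 = 0"
  using cinner_diff_right[of x 0 0] by simp

lemma cinner_self: "cinner x x = complex_of_real ((norm x)\<^sup>2)"
proof (rule complex_eqI)
  show "Re (cinner x x) = Re (complex_of_real ((norm x)\<^sup>2))"
    by (simp add: inner_eq_Re_cinner[symmetric] power2_norm_eq_inner)
  show "Im (cinner x x) = Im (complex_of_real ((norm x)\<^sup>2))"
    using arg_cong[OF cinner_commute[of x x], of Im] by simp
qed

lemma norm_scaleC: "norm (c *\<^sub>C x) = cmod c * norm (x::'a::complex_hilbert_space)"
proof -
  have "complex_of_real ((norm (c *\<^sub>C x))\<^sup>2) = c * cnj c * complex_of_real ((norm x)\<^sup>2)"
    by (simp only: cinner_self[symmetric] cinner_scaleC_left cinner_scaleC_right) simp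
  also have "\<dots> = complex_of_real ((cmod c * norm x)\<^sup>2)"
    by (simp add: complex_norm_square[symmetric] power_mult_distrib)
  finally show ?thesis
    by (simp only: of_real_eq_iff) (simp add: power2_eq_iff_nonneg)
qed

text \<open>Polarization over complex scalars: reality of the diagonal at \<open>x + y\<close> gives
  the imaginary part of the claim, at \<open>x + \<i> *\<^sub>C y\<close> the real part.\<close>

lemma sesquilinear_on_hermitian:
  assumes a: "sesquilinear_on V a" and V: "csubspace V"
    and real: "\<And>u. u \<in> V \<Longrightarrow> a u u \<in> \<real>" and x: "x \<in> V" and y: "y \<in> V"
  shows "a y x = cnj (a x y)"
proof -
  have "Im (a (x + c *\<^sub>C y) (x + c *\<^sub>C y)) = 0" for c
    using real[of "x + c *\<^sub>C y"] x y V by (simp add: csubspaceD complex_is_Real_iff)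
  moreover have "a (x + c *\<^sub>C y) (x + c *\<^sub>C y)
      = a x x + cnj c * a x y + c * a y x + c * cnj c * a y y" for c
    using x y V a by (simp add: sesquilinear_onD csubspaceD algebra_simps)
  ultimately have *: "Im (cnj c * a x y + c * a y x + c * cnj c * a y y) = 0" for c
    using real[OF x] by (simp add: complex_is_Real_iff)
  show ?thesis
    using *[of 1] *[of \<i>] real[OF y] by (simp add: complex_is_Real_iff complex_eq_iff)
qed

lemma sesquilinear_on_nonneg_diag:
  assumes "a u u \<in> \<real>\<^sub>\<ge>\<^sub>0"
  shows "a u u = complex_of_real (Re (a u u))" "0 \<le> Re (a u u)" "a u u \<in> \<real>"
  using assms by (auto simp: complex_nonneg_Reals_iff complex_is_Real_iff complex_eq_iff)

lemma sesquilinear_on_expand_nonneg: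
  assumes a: "sesquilinear_on V a" and V: "csubspace V"
    and nonneg: "\<And>u. u \<in> V \<Longrightarrow> a u u \<in> \<real>\<^sub>\<ge>\<^sub>0" and x: "x \<in> V" and y: "y \<in> V"
  shows "Re (a (x + c *\<^sub>C y) (x + c *\<^sub>C y))
    = Re (a x x) + 2 * Re (cnj c * a x y) + (cmod c)\<^sup>2 * Re (a y y)"
proof -
  have herm: "a y x = cnj (a x y)"
    by (rule sesquilinear_on_hermitian[OF a V _ x y]) (rule sesquilinear_on_nonneg_diag(3)[where a = a, OF nonneg])
  have "a (x + c *\<^sub>C y) (x + c *\<^sub>C y)
      = a x x + cnj c * a x y + c * a y x + c * cnj c * a y y"
    using x y V a by (simp add: sesquilinear_onD csubspaceD algebra_simps)
  then show ?thesis
    by (simp add: herm complex_norm_square[symmetric] del: of_real_power)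
qed

text \<open>The form may be degenerate, so the case \<open>a y y = 0\<close> is separated from the
  usual minimization of a quadratic polynomial.\<close>

lemma sesquilinear_on_Cauchy_Schwarz:
  assumes a: "sesquilinear_on V a" and V: "csubspace V"
    and nonneg: "\<And>u. u \<in> V \<Longrightarrow> a u u \<in> \<real>\<^sub>\<ge>\<^sub>0" and x: "x \<in> V" and y: "y \<in> V"
  shows "(cmod (a x y))\<^sup>2 \<le> Re (a x x) * Re (a y y)"
proof -
  let ?d = "a x y" and ?A = "Re (a x x)" and ?B = "Re (a y y)"
  have A: "0 \<le> ?A" and B: "0 \<le> ?B"
    using sesquilinear_on_nonneg_diag(2)[where a = a] nonneg x y by simp_all
  \<comment> \<open>The coefficient \<open>- t * a x y\<close> turns the cross term into a real
    number, leaving a quadratic in the real parameter \<open>t\<close>.\<close>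
  have *: "0 \<le> ?A - 2 * t * (cmod ?d)\<^sup>2 + t\<^sup>2 * (cmod ?d)\<^sup>2 * ?B" for t :: real
  proof -
    let ?c = "complex_of_real (- t) * ?d"
    have "0 \<le> Re (a (x + ?c *\<^sub>C y) (x + ?c *\<^sub>C y))"
      by (rule sesquilinear_on_nonneg_diag(2)[where a = a], rule nonneg) (use x y V in \<open>simp add: csubspaceD\<close>)
    also have "\<dots> = ?A + 2 * Re (cnj ?c * ?d) + (cmod ?c)\<^sup>2 * ?B"
      by (rule sesquilinear_on_expand_nonneg[OF a V nonneg x y])
    also have "cnj ?c * ?d = complex_of_real (- t * (cmod ?d)\<^sup>2)"
      using complex_norm_square[of ?d] by (simp add: mult_ac)
    finally show ?thesis by (simp add: norm_mult power_mult_distrib algebra_simps)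
  qed
  show ?thesis
  proof (cases "?B = 0")
    case True
    have "(cmod ?d)\<^sup>2 \<le> 0"
    proof (rule ccontr)
      assume "\<not> ?thesis"
      then have d: "0 < (cmod ?d)\<^sup>2" by simp
      \<comment> \<open>For \<open>?B = 0\<close> the bound is affine in \<open>t\<close>; this
        value of \<open>t\<close> makes its right side equal to -1.\<close>
      have "0 \<le> ?A - 2 * ((?A + 1) / (2 * (cmod ?d)\<^sup>2)) * (cmod ?d)\<^sup>2"
        using *[of "(?A + 1) / (2 * (cmod ?d)\<^sup>2)"] True by simp
      then show False using d by (simp add: field_simps)
    qed
    then show ?thesis using A B by (smt (verit) mult_nonneg_nonneg)
  next
    case False
    then have "0 < ?B" using B by simp
    then show ?thesis using *[of "1 / ?B"] by (simp add: field_simps power2_eq_square)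
  qed
qed

lemma cinner_Cauchy_Schwarz: "cmod (cinner x y) \<le> norm x * norm y"
proof -
  have "(cmod (cinner x y))\<^sup>2 \<le> Re (cinner x x) * Re (cinner y y)"
    by (rule sesquilinear_on_Cauchy_Schwarz[OF sesquilinear_on_cinner csubspace_UNIV])
       (simp_all add: cinner_self)
  then have "(cmod (cinner x y))\<^sup>2 \<le> (norm x * norm y)\<^sup>2"
    by (simp add: cinner_self power_mult_distrib)
  then show ?thesis by (rule power2_le_imp_le) simp
qed

lemma bounded_bilinear_cinner:
  "bounded_bilinear (cinner :: 'a::complex_hilbert_space \<Rightarrow> _)"
proof
  show "cinner (r *\<^sub>R x) y = r *\<^sub>R cinner x y" "cinner x (r *\<^sub>R y) = r *\<^sub>R cinner x y" for r and x y :: 'a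
    by (simp_all add: scaleR_scaleC cinner_scaleC_left cinner_scaleC_right scaleR_conv_of_real scaleC_complex_def)
  show "\<exists>K. \<forall>x y :: 'a. cmod (cinner x y) \<le> norm x * norm y * K"
    by (rule exI[of _ 1]) (simp add: cinner_Cauchy_Schwarz)
qed (simp_all add: cinner_add_left cinner_add_right)

lemmas tendsto_cinner = bounded_bilinear.tendsto[OF bounded_bilinear_cinner]

lemma cinner_dense_eqI:
  assumes "closure V = UNIV" "\<And>v. v \<in> V \<Longrightarrow> cinner x v = cinner y v"
  shows "x = y"
proof -
  obtain s where s: "\<And>n. s n \<in> V" "s \<longlonglongrightarrow> x - y"
    using assms(1) closure_sequential[of "x - y" V] by auto
  have "(\<lambda>n. cinner (x - y) (s n)) \<longlonglongrightarrow> cinner (x - y) (x - y)"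
    by (intro tendsto_cinner tendsto_const s)
  moreover have "cinner (x - y) (s n) = 0" for n
    using assms(2)[OF s(1)] by (simp add: cinner_diff_left)
  ultimately have "cinner (x - y) (x - y) = 0" by (simp add: LIMSEQ_const_iff)
  then show ?thesis by (simp add: cinner_self)
qed

text \<open>Uniform boundedness by Baire: the closed sets \<open>A n\<close> cover the space, so one
  of them contains a ball, and subtracting its centre bounds the functionals near 0.\<close>

lemma weakly_bounded_imp_bounded:
  fixes X :: "'a::complex_hilbert_space set"
  assumes "\<And>w. \<exists>C. \<forall>x\<in>X. cmod (cinner w x) \<le> C"
  shows "\<exists>C. \<forall>x\<in>X. norm x \<le> C"
proof -
  define A where "A n = {w. \<forall>x\<in>X. cmod (cinner w x) \<le> real n}" for n
  have "closed (A n)" for n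
  proof -
    have "A n = (\<Inter>x\<in>X. {w. cmod (cinner w x) \<le> real n})"
      unfolding A_def by blast
    moreover have "closed {w. cmod (cinner w x) \<le> real n}" for x
      by (intro closed_Collect_le continuous_intros
          bounded_linear.continuous_on[OF bounded_bilinear.bounded_linear_left[OF bounded_bilinear_cinner]])
    ultimately show ?thesis by auto
  qed
  moreover have "\<Union>(range A) = UNIV"
  proof -
    have "w \<in> \<Union>(range A)" for w
    proof -
      obtain C where "\<forall>x\<in>X. cmod (cinner w x) \<le> C" using assms by blast
      then have "w \<in> A (nat \<lceil>C\<rceil>)"
        unfolding A_def by (auto intro: order_trans real_nat_ceiling_ge)
      then show ?thesis by blast
    qed
    then show ?thesis by blast
  qed
  ultimately have "\<exists>n. interior (A n) \<noteq> {}"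
    using Baire_category_alt[of euclidean "range A"] completely_metrizable_space_euclidean
    by auto
  then obtain n w where "w \<in> interior (A n)" by blast
  then obtain e where e: "0 < e" "ball w e \<subseteq> A n"
    by (auto simp: mem_interior)
  have "norm x \<le> 4 * real n / e" if x: "x \<in> X" for x
  proof (cases "x = 0")
    case False
    \<comment> \<open>The multiple of \<open>x\<close> of length \<open>e / 2\<close> keeps
      \<open>w + v\<close> in the ball, while its inner product with \<open>x\<close> equals
      \<open>e / 2 * norm x\<close>; comparison with \<open>2 * real n\<close> gives the constant
      \<open>4 * real n / e\<close>.\<close>
    define v where "v = complex_of_real (e / (2 * norm x)) *\<^sub>C x"
    have c: "cmod (complex_of_real (e / (2 * norm x))) = e / (2 * norm x)"
      using e(1) by (simp only: norm_of_real) simp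
    have "norm v = e / 2" using False by (simp only: v_def norm_scaleC c) simp
    then have "w \<in> A n" "w + v \<in> A n" using e by (auto simp: dist_norm)
    then have "cmod (cinner w x) \<le> real n" "cmod (cinner (w + v) x) \<le> real n"
      using x by (auto simp: A_def)
    moreover have "cinner v x = cinner (w + v) x - cinner w x" by (simp add: cinner_add_left)
    ultimately have "cmod (cinner v x) \<le> 2 * real n"
      using norm_triangle_ineq4[of "cinner (w + v) x" "cinner w x"] by simp
    moreover have "cmod (cinner v x) = e / 2 * norm x"
      unfolding v_def cinner_scaleC_left cinner_self norm_mult c
      using False by (simp add: power2_eq_square norm_mult)
    ultimately show ?thesis using e(1) by (simp add: field_simps)
  qed (use e in simp)
  then show ?thesis by blast
qed

section \<open>Riesz representation\<close>

text \<open>Riesz representation without completeness. The energy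
  \<open>a u u - 2 * Re (F u)\<close> need not attain its infimum on \<open>V\<close>, but a
  minimizing sequence is Cauchy and satisfies the Euler equation in the limit. The limit is taken by
  the callers, in the ambient space or in the form domain.\<close>

lemma minimizing_sequence_represents:
  assumes a: "sesquilinear_on V a" and V: "csubspace V"
    and nonneg: "\<And>u. u \<in> V \<Longrightarrow> a u u \<in> \<real>\<^sub>\<ge>\<^sub>0"
    and F_add: "\<And>x y. x \<in> V \<Longrightarrow> y \<in> V \<Longrightarrow> F (x + y) = F x + F y"
    and F_scale: "\<And>c x. x \<in> V \<Longrightarrow> F (c *\<^sub>C x) = cnj c * F x"
    and F_bound: "\<And>x. x \<in> V \<Longrightarrow> cmod (F x) \<le> C * sqrt (Re (a x x))"
  obtains u :: "nat \<Rightarrow> 'a::complex_hilbert_space"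
  where "\<And>n. u n \<in> V"
    and "\<And>e. e > 0 \<Longrightarrow> \<exists>N. \<forall>m\<ge>N. \<forall>n\<ge>N. sqrt (Re (a (u m - u n) (u m - u n))) < e"
    and "\<And>v. v \<in> V \<Longrightarrow> (\<lambda>n. a (u n) v) \<longlonglongrightarrow> F v"
proof -
  define J where "J u = Re (a u u) - 2 * Re (F u)" for u
  have pos: "0 \<le> Re (a u u)" if "u \<in> V" for u
    using sesquilinear_on_nonneg_diag(2)[where a = a] nonneg[OF that] by simp
  \<comment> \<open>Completing the square in the seminorm \<open>sqrt (Re (a u u))\<close>.\<close>
  have below: "- C\<^sup>2 \<le> J u" if u: "u \<in> V" for u
  proof -
    let ?s = "sqrt (Re (a u u))"
    have "Re (F u) \<le> C * ?s" using F_bound[OF u] complex_Re_le_cmod order_trans by blast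
    moreover have "?s\<^sup>2 = Re (a u u)" using pos[OF u] by simp
    moreover have "0 \<le> ?s\<^sup>2 - 2 * (C * ?s) + C\<^sup>2"
      using zero_le_power2[of "?s - C"] unfolding power2_diff by (simp only: mult_ac)
    ultimately show ?thesis unfolding J_def by linarith
  qed
  define m where "m = Inf (J ` V)"
  have V_ne: "J ` V \<noteq> {}" using V by (auto simp: csubspace_def)
  have bdd: "bdd_below (J ` V)" using below by (auto intro!: bdd_belowI)
  have m_le: "m \<le> J u" if "u \<in> V" for u
    unfolding m_def using bdd that by (auto intro: cInf_lower)
  have "\<exists>u\<in>V. J u < m + 1 / real (Suc n)" for n
    using cInf_lessD[OF V_ne, of "m + 1 / real (Suc n)"] unfolding m_def by auto
  then obtain u where u: "\<And>n. u n \<in> V" "\<And>n. J (u n) < m + 1 / real (Suc n)"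
    by metis
  have J_expand: "J (x + c *\<^sub>C y) = J x + 2 * Re (cnj c * (a x y - F y)) + (cmod c)\<^sup>2 * Re (a y y)"
    if "x \<in> V" "y \<in> V" for x y c
  proof -
    have "Re (a (x + c *\<^sub>C y) (x + c *\<^sub>C y))
        = Re (a x x) + 2 * Re (cnj c * a x y) + (cmod c)\<^sup>2 * Re (a y y)"
      by (rule sesquilinear_on_expand_nonneg[OF a V]) (use that nonneg in auto)
    then show ?thesis
      using that V unfolding J_def by (simp add: F_add F_scale csubspaceD algebra_simps)
  qed
  \<comment> \<open>The midpoint of \<open>x\<close> and \<open>y\<close> has energy at least
    \<open>m\<close>, and the parallelogram law turns this into a bound on their distance.\<close>
  have parallelogram: "Re (a (x - y) (x - y)) \<le> 2 * (J x - m) + 2 * (J y - m)"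
    if x: "x \<in> V" and y: "y \<in> V" for x y
  proof -
    have mid: "x + (1 / 2) *\<^sub>C (y - x) \<in> V" using V x y by (simp add: csubspaceD csubspace_diff)
    have "J y = J (x + 1 *\<^sub>C (y - x))" by (simp add: scaleC_one)
    then have Jy: "J y = J x + 2 * Re (a x (y - x) - F (y - x)) + Re (a (y - x) (y - x))"
      using J_expand[OF x, of "y - x" 1] csubspace_diff[OF V y x] by simp
    have "m \<le> J x + Re (a x (y - x) - F (y - x)) + Re (a (y - x) (y - x)) / 4"
    proof -
      have "Re (cnj (1 / 2) * w) = Re w / 2" for w by simp
      moreover have "(cmod (1 / 2))\<^sup>2 = 1 / 4" by (simp add: norm_divide power2_eq_square)
      ultimately have "J (x + (1 / 2) *\<^sub>C (y - x))
          = J x + 2 * (Re (a x (y - x) - F (y - x)) / 2) + 1 / 4 * Re (a (y - x) (y - x))"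
        using J_expand[OF x csubspace_diff[OF V y x], of "1 / 2"] by (simp only:)
      then show ?thesis using m_le[OF mid] by linarith
    qed
    moreover have "a (x - y) (x - y) = a (y - x) (y - x)"
      using a V x y by (simp add: sesquilinear_on_diff csubspace_diff)
    ultimately show ?thesis using Jy by simp
  qed
  show ?thesis
  proof
    show "u n \<in> V" for n by (rule u)
  next
    fix e :: real assume e: "0 < e"
    \<comment> \<open>Each of the two excess energies enters the parallelogram bound with factor 2,
      so \<open>e\<^sup>2 / 4\<close> for each adds up to \<open>e\<^sup>2\<close>.\<close>
    obtain N where N: "1 / real (Suc N) < e\<^sup>2 / 4"
      using e nat_approx_posE[of "e\<^sup>2 / 4"] by auto
    have tail: "J (u n) - m < e\<^sup>2 / 4" if "N \<le> n" for n
    proof -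
      have "1 / real (Suc n) \<le> 1 / real (Suc N)" using that by (simp add: frac_le)
      then show ?thesis using u(2)[of n] N by simp
    qed
    have "sqrt (Re (a (u k - u n) (u k - u n))) < e" if "N \<le> k" "N \<le> n" for k n
    proof -
      have "Re (a (u k - u n) (u k - u n)) < e\<^sup>2"
        using parallelogram[OF u(1) u(1), of k n] tail[OF that(1)] tail[OF that(2)] by simp
      then show ?thesis using e by (intro real_less_lsqrt) auto
    qed
    then show "\<exists>N. \<forall>m\<ge>N. \<forall>n\<ge>N. sqrt (Re (a (u m - u n) (u m - u n))) < e" by blast
  next
    fix v assume v: "v \<in> V"
    let ?B = "Re (a v v)"
    have B: "0 \<le> ?B" by (rule pos[OF v])
    \<comment> \<open>A near minimizer has small derivative: moving from \<open>u n\<close> along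
      \<open>v\<close> by \<open>- t\<close> times the defect lowers the energy by at least
      \<open>t\<close> times its squared modulus. Taking \<open>t = 1 / (?B + 1)\<close> keeps
      \<open>t * ?B\<close> at most 1, also for \<open>?B = 0\<close>.\<close>
    have bound: "(cmod (a (u n) v - F v))\<^sup>2 \<le> (?B + 1) * (1 / real (Suc n))" for n
    proof -
      let ?d = "a (u n) v - F v"
      define t where "t = 1 / (?B + 1)"
      have t: "0 < t" "t * ?B \<le> 1" using B by (auto simp: t_def)
      let ?c = "complex_of_real (- t) * ?d"
      have "u n + ?c *\<^sub>C v \<in> V" using u(1) v V by (simp add: csubspaceD)
      from m_le[OF this] have "m \<le> J (u n) + 2 * Re (cnj ?c * ?d) + (cmod ?c)\<^sup>2 * ?B"
        unfolding J_expand[OF u(1) v] .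
      also have "cnj ?c * ?d = complex_of_real (- t * (cmod ?d)\<^sup>2)"
        using complex_norm_square[of ?d] by (simp add: mult_ac)
      also have "(cmod ?c)\<^sup>2 * ?B = t * (cmod ?d)\<^sup>2 * (t * ?B)"
        by (simp add: norm_mult power_mult_distrib power2_eq_square)
      also have "\<dots> \<le> t * (cmod ?d)\<^sup>2 * 1" using t by (intro mult_left_mono) auto
      finally have "t * (cmod ?d)\<^sup>2 \<le> 1 / real (Suc n)" using u(2)[of n] by simp
      then show ?thesis using B by (simp add: t_def field_simps)
    qed
    have "(\<lambda>n. (?B + 1) * (1 / real (Suc n))) \<longlonglongrightarrow> (?B + 1) * 0"
      using tendsto_mult[OF tendsto_const LIMSEQ_inverse_real_of_nat, of "?B + 1"]
      unfolding inverse_eq_divide .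
    then have g: "(\<lambda>n. (?B + 1) * (1 / real (Suc n))) \<longlonglongrightarrow> 0" by (simp only: mult_zero_right)
    have "(\<lambda>n. (cmod (a (u n) v - F v))\<^sup>2) \<longlonglongrightarrow> 0"
    proof (rule Lim_null_comparison[OF _ g])
      show "\<forall>\<^sub>F n in sequentially.
          norm ((cmod (a (u n) v - F v))\<^sup>2) \<le> (?B + 1) * (1 / real (Suc n))"
        by (rule always_eventually) (use bound in \<open>simp del: of_nat_Suc\<close>)
    qed
    then have "(\<lambda>n. sqrt ((cmod (a (u n) v - F v))\<^sup>2)) \<longlonglongrightarrow> sqrt 0"
      by (intro tendsto_real_sqrt)
    then have "(\<lambda>n. a (u n) v - F v) \<longlonglongrightarrow> 0"
      by (simp add: tendsto_norm_zero_iff)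
    then show "(\<lambda>n. a (u n) v) \<longlonglongrightarrow> F v" using LIM_zero_iff by blast
  qed
qed

lemma riesz_dense:
  fixes V :: "'a::complex_hilbert_space set"
  assumes V: "csubspace V" and dense: "closure V = UNIV"
    and F_add: "\<And>x y. x \<in> V \<Longrightarrow> y \<in> V \<Longrightarrow> F (x + y) = F x + F y"
    and F_scale: "\<And>c x. x \<in> V \<Longrightarrow> F (c *\<^sub>C x) = cnj c * F x"
    and F_bound: "\<And>x. x \<in> V \<Longrightarrow> cmod (F x) \<le> C * norm x"
    and C: "0 \<le> C"
  obtains w where "\<And>v. v \<in> V \<Longrightarrow> cinner w v = F v" "norm w \<le> C"
proof -
  have sqrt_norm: "sqrt (Re (cinner x x)) = norm x" for x :: 'a by (simp add: cinner_self)
  obtain u where u: "\<And>n. u n \<in> V"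
      "\<And>e. e > 0 \<Longrightarrow> \<exists>N. \<forall>m\<ge>N. \<forall>n\<ge>N. norm (u m - u n) < e"
      "\<And>v. v \<in> V \<Longrightarrow> (\<lambda>n. cinner (u n) v) \<longlonglongrightarrow> F v"
    using minimizing_sequence_represents[OF sesquilinear_on_cinner V _ F_add F_scale, of C]
      F_bound unfolding sqrt_norm by (auto simp: cinner_self)
  have "Cauchy u" unfolding Cauchy_def dist_norm using u(2) by blast
  then obtain w where w: "u \<longlonglongrightarrow> w" using Cauchy_convergent convergent_def by blast
  have eq: "cinner w v = F v" if v: "v \<in> V" for v
    using LIMSEQ_unique[OF tendsto_cinner[OF w tendsto_const] u(3)[OF v]] .
  \<comment> \<open>The representing vector may lie outside \<open>V\<close>, so the bound on
    \<open>F\<close> is tested along a sequence in \<open>V\<close> converging to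
    \<open>w\<close>.\<close>
  obtain s where s: "\<And>n. s n \<in> V" "s \<longlonglongrightarrow> w"
    using dense closure_sequential[of w V] by auto
  have "(\<lambda>n. cmod (cinner w (s n))) \<longlonglongrightarrow> cmod (cinner w w)"
    by (intro tendsto_norm tendsto_cinner tendsto_const s)
  moreover have "(\<lambda>n. C * norm (s n)) \<longlonglongrightarrow> C * norm w"
    by (intro tendsto_intros s)
  ultimately have "cmod (cinner w w) \<le> C * norm w"
    using LIMSEQ_le[of "\<lambda>n. cmod (cinner w (s n))" "cmod (cinner w w)"] eq[OF s(1)] F_bound[OF s(1)]
    by auto
  then have "norm w * norm w \<le> C * norm w"
    by (simp add: cinner_self power2_eq_square norm_mult)
  then have "norm w \<le> C"
    using C by (cases "w = 0") auto
  then show ?thesis using that eq by blast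
qed

section \<open>Adjoints of bounded maps on dense subspaces, and operators of Gram forms\<close>

lemma ex_adjoint:
  fixes T :: "'a::complex_hilbert_space \<Rightarrow> 'b::complex_hilbert_space"
  assumes V: "csubspace V" and dense: "closure V = UNIV" and T: "clinear_on V T"
    and bound: "\<And>v. v \<in> V \<Longrightarrow> norm (T v) \<le> C * norm v"
  obtains T' where "bounded_op T'" "\<And>w v. v \<in> V \<Longrightarrow> cinner (T' w) v = cinner w (T v)"
proof -
  have bound': "norm (T v) \<le> \<bar>C\<bar> * norm v" if "v \<in> V" for v
    using bound[OF that] by (rule order_trans) (simp add: mult_right_mono)
  have "\<exists>x. (\<forall>v\<in>V. cinner x v = cinner w (T v)) \<and> norm x \<le> \<bar>C\<bar> * norm w" for w
  proof (rule riesz_dense[OF V dense, of "\<lambda>v. cinner w (T v)" "\<bar>C\<bar> * norm w"])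
    show "cinner w (T (x + y)) = cinner w (T x) + cinner w (T y)" if "x \<in> V" "y \<in> V" for x y
      using that T by (simp add: clinear_onD cinner_add_right)
    show "cinner w (T (c *\<^sub>C x)) = cnj c * cinner w (T x)" if "x \<in> V" for c x
      using that T by (simp add: clinear_onD cinner_scaleC_right)
    show "cmod (cinner w (T x)) \<le> \<bar>C\<bar> * norm w * norm x" if "x \<in> V" for x
      using cinner_Cauchy_Schwarz[of w "T x"] mult_left_mono[OF bound'[OF that], of "norm w"]
      by (simp add: mult_ac)
  qed auto
  then obtain T' where T': "\<And>w v. v \<in> V \<Longrightarrow> cinner (T' w) v = cinner w (T v)"
      "\<And>w. norm (T' w) \<le> \<bar>C\<bar> * norm w"
    by metis
  have "T' (x + y) = T' x + T' y" for x y
    by (rule cinner_dense_eqI[OF dense]) (simp add: T' cinner_add_left)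
  moreover have "T' (c *\<^sub>C x) = c *\<^sub>C T' x" for c x
    by (rule cinner_dense_eqI[OF dense]) (simp add: T' cinner_scaleC_left)
  ultimately have "bounded_op T'"
    unfolding bounded_op_def clinear_on_def using T'(2) by blast
  then show ?thesis using that T'(1) by blast
qed

text \<open>
  The operator of the form \<open>\<langle>T x, T y\<rangle>\<close> is \<open>T\<^sup>* T\<close>, where the bounded extension of \<open>T\<close> to the
  whole space is its double adjoint.
\<close>

lemma ex_op_of_gram_form:
  fixes T :: "'a::complex_hilbert_space \<Rightarrow> 'b::complex_hilbert_space"
  assumes V: "csubspace V" and dense: "closure V = UNIV" and T: "clinear_on V T"
    and bound: "\<And>v. v \<in> V \<Longrightarrow> norm (T v) \<le> C * norm v"
  obtains Q where "form_assoc_bounded_op V (\<lambda>x y. cinner (T x) (T y)) Q"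
proof -
  obtain T' where T': "bounded_op T'" "\<And>w v. v \<in> V \<Longrightarrow> cinner (T' w) v = cinner w (T v)"
    using ex_adjoint[OF V dense T bound] by blast
  obtain C' where C': "\<And>w. norm (T' w) \<le> C' * norm w" using T'(1) by (auto simp: bounded_op_def)
  have "clinear_on UNIV T'" using T'(1) by (simp add: bounded_op_def)
  then obtain T'' where T'': "bounded_op T''" "\<And>x w. cinner (T'' x) w = cinner x (T' w)"
    using ex_adjoint[OF csubspace_UNIV closure_UNIV _ C'] by (metis UNIV_I)
  have ext: "T'' x = T x" if x: "x \<in> V" for x
  proof (rule cinner_dense_eqI[OF closure_UNIV])
    fix w
    have "cinner (T'' x) w = cnj (cinner (T' w) x)" unfolding T'' by (rule cinner_commute)
    also have "\<dots> = cinner (T x) w" unfolding T'(2)[OF x] by (rule cinner_commute[symmetric])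
    finally show "cinner (T'' x) w = cinner (T x) w" .
  qed
  obtain C'' where C'': "\<And>x. norm (T'' x) \<le> C'' * norm x" using T''(1) by (auto simp: bounded_op_def)
  have "norm (T' (T'' x)) \<le> (\<bar>C'\<bar> * C'') * norm x" for x
  proof -
    have "norm (T' (T'' x)) \<le> \<bar>C'\<bar> * norm (T'' x)"
      using C'[of "T'' x"] by (rule order_trans) (simp add: mult_right_mono)
    also have "\<dots> \<le> \<bar>C'\<bar> * (C'' * norm x)" using C'' by (simp add: mult_left_mono)
    finally show ?thesis by (simp add: mult_ac)
  qed
  then have "bounded_op (\<lambda>x. T' (T'' x))"
    using T'(1) T''(1) unfolding bounded_op_def clinear_on_def by auto
  then have "form_assoc_bounded_op V (\<lambda>x y. cinner (T x) (T y)) (\<lambda>x. T' (T'' x))"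
    by (simp add: form_assoc_bounded_op_def T'(2) ext)
  then show ?thesis using that by blast
qed

lemma bounded_op_dense_unique:
  fixes P Q :: "'a::complex_hilbert_space \<Rightarrow> 'b::complex_hilbert_space"
  assumes dense: "closure V = UNIV" and P: "bounded_op P" and Q: "bounded_op Q"
    and eq: "\<And>x. x \<in> V \<Longrightarrow> P x = Q x"
  shows "P = Q"
proof (rule ext)
  fix x
  have cont: "(\<lambda>n. T (s n)) \<longlonglongrightarrow> T x" if T: "bounded_op T" and s: "s \<longlonglongrightarrow> x"
    for T :: "'a \<Rightarrow> 'b" and s
  proof -
    obtain C where C: "\<And>x. norm (T x) \<le> C * norm x" and lin: "clinear_on UNIV T"
      using T by (auto simp: bounded_op_def)
    have "(\<lambda>n. C * norm (s n - x)) \<longlonglongrightarrow> C * norm (x - x)"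
      by (intro tendsto_intros s)
    then have "(\<lambda>n. C * norm (s n - x)) \<longlonglongrightarrow> 0" by simp
    then have "(\<lambda>n. T (s n - x)) \<longlonglongrightarrow> 0"
      by (rule Lim_null_comparison[rotated]) (simp add: C)
    then show ?thesis
      unfolding clinear_on_diff[OF lin csubspace_UNIV UNIV_I UNIV_I] by (rule LIM_zero_cancel)
  qed
  obtain s where s: "\<And>n. s n \<in> V" "s \<longlonglongrightarrow> x"
    using dense closure_sequential[of x V] by auto
  have "(\<lambda>n. P (s n)) \<longlonglongrightarrow> P x" "(\<lambda>n. P (s n)) \<longlonglongrightarrow> Q x"
    using cont[OF P s(2)] cont[OF Q s(2)] eq s(1) by simp_all
  then show "P x = Q x" by (rule LIMSEQ_unique)
qed

text \<open>Supplies the uniqueness behind the definite description in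
  \<open>solution_form_op\<close>.\<close>

lemma form_assoc_bounded_op_unique:
  assumes dense: "closure V = UNIV"
    and P: "form_assoc_bounded_op V a P" and Q: "form_assoc_bounded_op V a Q"
  shows "P = Q"
proof (rule bounded_op_dense_unique[OF dense])
  show "bounded_op P" "bounded_op Q"
    using P Q by (simp_all add: form_assoc_bounded_op_def)
  show "P x = Q x" if "x \<in> V" for x
    using P Q that by (intro cinner_dense_eqI[OF dense]) (metis form_assoc_bounded_op_def)
qed

section \<open>Closed forms and their operators\<close>

text \<open>The weak form of \<open>(A - z) u = w\<close> for the operator \<open>A\<close> of the
  form. As a relation it presupposes neither solvability nor the definite description in
  \<open>form_op\<close>.\<close>

definition weak_resolvent_rel ::
    "'a::complex_hilbert_space set \<Rightarrow> 'a form \<Rightarrow> complex \<Rightarrow> 'a \<Rightarrow> 'a \<Rightarrow> bool"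
  where "weak_resolvent_rel V a z u w \<longleftrightarrow>
    u \<in> V \<and> (\<forall>v\<in>V. a u v - z * cinner u v = cinner w v)"

lemma form_op_eqI:
  assumes dense: "closure V = UNIV" and u: "u \<in> V" "\<And>v. v \<in> V \<Longrightarrow> a u v = cinner w v"
  shows "u \<in> form_op_dom V a" "form_op V a u = w"
proof -
  show "u \<in> form_op_dom V a" using u by (auto simp: form_op_dom_def)
  show "form_op V a u = w" unfolding form_op_def
    by (rule the_equality) (use u cinner_dense_eqI[OF dense] in auto)
qed

locale closed_form =
  fixes V :: "'a::complex_hilbert_space set" and a :: "'a form"
  assumes closed_nonneg: "closed_nonneg_form V a"
begin

lemma subspace: "csubspace V" and dense: "closure V = UNIV" and sesq: "sesquilinear_on V a"
  and nonneg: "u \<in> V \<Longrightarrow> a u u \<in> \<real>\<^sub>\<ge>\<^sub>0"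
  using closed_nonneg by (auto simp: closed_nonneg_form_def)

lemma diag_nonneg: "u \<in> V \<Longrightarrow> 0 \<le> Re (a u u)" and diag_Im: "u \<in> V \<Longrightarrow> Im (a u u) = 0"
  using nonneg[of u] by (auto simp: complex_nonneg_Reals_iff)

lemma hermitian: "x \<in> V \<Longrightarrow> y \<in> V \<Longrightarrow> a y x = cnj (a x y)"
  by (rule sesquilinear_on_hermitian[OF sesq subspace])
     (auto simp: complex_is_Real_iff diag_Im)

abbreviation inner1 :: "'a form"
  where "inner1 u v \<equiv> a u v + cinner u v"

lemma inner1_sesq: "sesquilinear_on V inner1"
  using sesq by (auto simp: sesquilinear_on_def cinner_add_left cinner_add_right
      cinner_scaleC_left cinner_scaleC_right algebra_simps)

lemma inner1_nonneg: "u \<in> V \<Longrightarrow> inner1 u u \<in> \<real>\<^sub>\<ge>\<^sub>0"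
  using diag_nonneg diag_Im by (simp add: complex_nonneg_Reals_iff cinner_self)

lemma inner1_norm: "sqrt (Re (inner1 u u)) = form_norm a u"
  by (simp add: form_norm_def cinner_self)

lemma form_norm_nonneg: "u \<in> V \<Longrightarrow> 0 \<le> form_norm a u"
  using diag_nonneg by (simp add: form_norm_def)

lemma form_norm_sq: "u \<in> V \<Longrightarrow> (form_norm a u)\<^sup>2 = Re (a u u) + (norm u)\<^sup>2"
  using diag_nonneg by (simp add: form_norm_def)

lemma norm_le_form_norm: "u \<in> V \<Longrightarrow> norm u \<le> form_norm a u"
  by (rule power2_le_imp_le) (auto simp: form_norm_sq form_norm_nonneg diag_nonneg)

lemma inner1_Cauchy_Schwarz:
  assumes "x \<in> V" "y \<in> V"
  shows "cmod (inner1 x y) \<le> form_norm a x * form_norm a y"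
proof (rule power2_le_imp_le)
  show "(cmod (inner1 x y))\<^sup>2 \<le> (form_norm a x * form_norm a y)\<^sup>2"
    using sesquilinear_on_Cauchy_Schwarz[OF inner1_sesq subspace inner1_nonneg assms]
    by (simp add: power_mult_distrib form_norm_sq assms cinner_self)
qed (simp add: form_norm_nonneg assms)

lemma complete:
  assumes "\<And>n. u n \<in> V"
    and "\<And>e. e > 0 \<Longrightarrow> \<exists>N. \<forall>m\<ge>N. \<forall>n\<ge>N. form_norm a (u m - u n) < e"
  obtains l where "l \<in> V" "(\<lambda>n. form_norm a (u n - l)) \<longlonglongrightarrow> 0"
  using closed_nonneg assms unfolding closed_nonneg_form_def by blast

lemma inner1_tendsto:
  assumes u: "\<And>n. u n \<in> V" and l: "l \<in> V" and lim: "(\<lambda>n. form_norm a (u n - l)) \<longlonglongrightarrow> 0"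
    and v: "v \<in> V"
  shows "(\<lambda>n. inner1 (u n) v) \<longlonglongrightarrow> inner1 l v"
proof (rule LIM_zero_cancel, rule Lim_null_comparison)
  show "\<forall>\<^sub>F n in sequentially.
      norm (inner1 (u n) v - inner1 l v) \<le> form_norm a (u n - l) * form_norm a v"
    using inner1_Cauchy_Schwarz[OF csubspace_diff[OF subspace u l] v]
      sesquilinear_on_diff(1)[OF inner1_sesq subspace v u l]
    by simp
  show "(\<lambda>n. form_norm a (u n - l) * form_norm a v) \<longlonglongrightarrow> 0"
    using tendsto_mult_right[OF lim, of "form_norm a v"] by simp
qed

lemma riesz:
  assumes "\<And>x y. x \<in> V \<Longrightarrow> y \<in> V \<Longrightarrow> F (x + y) = F x + F y"
    and "\<And>c x. x \<in> V \<Longrightarrow> F (c *\<^sub>C x) = cnj c * F x"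
    and "\<And>x. x \<in> V \<Longrightarrow> cmod (F x) \<le> C * form_norm a x"
  obtains u where "u \<in> V" "\<And>v. v \<in> V \<Longrightarrow> inner1 u v = F v"
proof -
  obtain u where u: "\<And>n. u n \<in> V"
      "\<And>e. e > 0 \<Longrightarrow> \<exists>N. \<forall>m\<ge>N. \<forall>n\<ge>N. form_norm a (u m - u n) < e"
      "\<And>v. v \<in> V \<Longrightarrow> (\<lambda>n. inner1 (u n) v) \<longlonglongrightarrow> F v"
    using minimizing_sequence_represents[OF inner1_sesq subspace inner1_nonneg assms(1,2), of C]
      assms(3) unfolding inner1_norm by blast
  obtain l where l: "l \<in> V" "(\<lambda>n. form_norm a (u n - l)) \<longlonglongrightarrow> 0"
    using complete[OF u(1,2)] by blast
  have "inner1 l v = F v" if "v \<in> V" for v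
    using inner1_tendsto[OF u(1) l that] u(3)[OF that] by (rule LIMSEQ_unique)
  then show ?thesis using that l(1) by blast
qed

lemma form_op_represents:
  assumes "u \<in> form_op_dom V a"
  shows "u \<in> V" "v \<in> V \<Longrightarrow> a u v = cinner (form_op V a u) v"
proof -
  obtain w where w: "u \<in> V" "\<And>v. v \<in> V \<Longrightarrow> a u v = cinner w v"
    using assms by (auto simp: form_op_dom_def)
  then show "u \<in> V" "v \<in> V \<Longrightarrow> a u v = cinner (form_op V a u) v"
    using form_op_eqI(2)[where a = a, OF dense w] by auto
qed

section \<open>Weak resolvent equations and the resolvent set of a form operator\<close>

abbreviation "wr \<equiv> weak_resolvent_rel V a"

lemma weak_resolvent_rel_iff:
  "wr z u w \<longleftrightarrow> u \<in> form_op_dom V a \<and> form_op V a u - z *\<^sub>C u = w"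
proof
  assume *: "wr z u w"
  then have "u \<in> V" and "\<And>v. v \<in> V \<Longrightarrow> a u v = cinner (w + z *\<^sub>C u) v"
    by (auto simp: weak_resolvent_rel_def cinner_add_left cinner_scaleC_left algebra_simps)
  from form_op_eqI[where a = a, OF dense this] show "u \<in> form_op_dom V a \<and> form_op V a u - z *\<^sub>C u = w" by simp
next
  assume *: "u \<in> form_op_dom V a \<and> form_op V a u - z *\<^sub>C u = w"
  then show "wr z u w"
    using form_op_represents[of u]
    by (auto simp: weak_resolvent_rel_def cinner_diff_left cinner_scaleC_left)
qed

lemma weak_resolvent_rel_diff:
  assumes "wr z u w" "wr z u' w'"
  shows "wr z (u - u') (w - w')"
  using assms subspace sesq
  by (auto simp: weak_resolvent_rel_def cinner_diff_left csubspace_diff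
      sesquilinear_on_diff algebra_simps)

lemma weak_resolvent_rel_shift:
  "wr z u w \<longleftrightarrow> wr z0 u (w + (z - z0) *\<^sub>C u)"
  by (auto simp: weak_resolvent_rel_def cinner_add_left cinner_scaleC_left algebra_simps)

text \<open>Injectivity is absorbed by the a priori bound: the difference of two solutions solves
  the equation with right side 0.\<close>

lemma mem_resolvent_set_iff:
  "z \<in> resolvent_set (form_op_dom V a) (form_op V a) \<longleftrightarrow>
    (\<forall>w. \<exists>u. wr z u w) \<and> (\<exists>C. \<forall>u w. wr z u w \<longrightarrow> norm u \<le> C * norm w)"
  (is "?L \<longleftrightarrow> ?R")
proof
  assume L: ?L
  have "\<exists>u. wr z u w" for w
  proof -
    have "w \<in> (\<lambda>u. form_op V a u - z *\<^sub>C u) ` form_op_dom V a"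
      using L by (simp add: resolvent_set_def bij_betw_def)
    then show ?thesis by (auto simp: weak_resolvent_rel_iff)
  qed
  moreover have "\<exists>C. \<forall>u w. wr z u w \<longrightarrow> norm u \<le> C * norm w"
    using L by (auto simp: resolvent_set_def weak_resolvent_rel_iff)
  ultimately show ?R by blast
next
  assume R: ?R
  then obtain C where C: "\<And>u w. wr z u w \<Longrightarrow> norm u \<le> C * norm w" by blast
  have "inj_on (\<lambda>u. form_op V a u - z *\<^sub>C u) (form_op_dom V a)"
  proof (rule inj_onI)
    fix x y assume "x \<in> form_op_dom V a" "y \<in> form_op_dom V a"
      "form_op V a x - z *\<^sub>C x = form_op V a y - z *\<^sub>C y"
    then have "wr z (x - y) 0"
      using weak_resolvent_rel_diff[of z x _ y] by (auto simp: weak_resolvent_rel_iff)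
    from C[OF this] show "x = y" by simp
  qed
  moreover have "w \<in> (\<lambda>u. form_op V a u - z *\<^sub>C u) ` form_op_dom V a" for w
  proof -
    obtain u where "wr z u w" using R by blast
    then show ?thesis unfolding weak_resolvent_rel_iff by blast
  qed
  ultimately show ?L
    using R by (auto simp: resolvent_set_def bij_betw_def weak_resolvent_rel_iff)
qed

lemma weak_resolvent_rel_unique:
  assumes "z \<in> resolvent_set (form_op_dom V a) (form_op V a)" "wr z u w" "wr z u' w"
  shows "u = u'"
proof -
  obtain C where "\<And>u w. wr z u w \<Longrightarrow> norm u \<le> C * norm w"
    using assms(1) mem_resolvent_set_iff by blast
  from this[OF weak_resolvent_rel_diff[OF assms(2,3)]] show ?thesis by simp
qed

text \<open>\<open>(A - z) u = w\<close> is the fixed point equation \<open>u = R(z0) (w + (z - z0) u)\<close>.\<close>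

lemma resolvent_perturb:
  assumes solv: "\<And>w. \<exists>u. wr z0 u w"
    and bound: "\<And>u w. wr z0 u w \<Longrightarrow> norm u \<le> C * norm w"
    and C: "0 \<le> C" "C * cmod (z - z0) < 1"
  shows "\<exists>u. wr z u w"
    and "wr z u w \<Longrightarrow> norm u \<le> C / (1 - C * cmod (z - z0)) * norm w"
proof -
  obtain R where R: "\<And>w. wr z0 (R w) w" using solv by metis
  define f where "f u = R (w + (z - z0) *\<^sub>C u)" for u
  have "dist (f x) (f y) \<le> (C * cmod (z - z0)) * dist x y" for x y
    using bound[OF weak_resolvent_rel_diff[OF R R], of "w + (z - z0) *\<^sub>C x" "w + (z - z0) *\<^sub>C y"]
    by (simp add: f_def dist_norm scaleC_diff_right[symmetric] norm_scaleC mult_ac)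
  then have "\<exists>!x. f x = x"
    using C by (intro banach_fix_type[of "C * cmod (z - z0)"]) auto
  then obtain x where "f x = x" by blast
  then have "wr z0 x (w + (z - z0) *\<^sub>C x)" using R f_def by metis
  then show "\<exists>u. wr z u w" using weak_resolvent_rel_shift by blast
next
  assume "wr z u w"
  then have "wr z0 u (w + (z - z0) *\<^sub>C u)" by (subst (asm) weak_resolvent_rel_shift[of _ _ _ z0])
  from bound[OF this] have "norm u \<le> C * norm (w + (z - z0) *\<^sub>C u)" .
  also have "\<dots> \<le> C * (norm w + cmod (z - z0) * norm u)"
    using C(1) norm_triangle_ineq[of w "(z - z0) *\<^sub>C u"]
    by (simp add: norm_scaleC mult_left_mono)
  finally have "norm u * (1 - C * cmod (z - z0)) \<le> C * norm w" by (simp add: algebra_simps)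
  then show "norm u \<le> C / (1 - C * cmod (z - z0)) * norm w"
    using C(2) by (simp add: pos_le_divide_eq)
qed

text \<open>Makes the resolvent bound uniform over a disc; this uniformity later yields estimates on
  \<open>S z\<close> that are linear in the distance of the parameters.\<close>

lemma resolvent_locally_bounded:
  assumes "z0 \<in> resolvent_set (form_op_dom V a) (form_op V a)"
  obtains d C where "0 < d" "0 \<le> C"
    "\<And>z. cmod (z - z0) < d \<Longrightarrow> z \<in> resolvent_set (form_op_dom V a) (form_op V a)"
    "\<And>z u w. cmod (z - z0) < d \<Longrightarrow> wr z u w \<Longrightarrow> norm u \<le> C * norm w"
proof -
  obtain B where solv: "\<And>w. \<exists>u. wr z0 u w" and B: "\<And>u w. wr z0 u w \<Longrightarrow> norm u \<le> B * norm w"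
    using assms mem_resolvent_set_iff by blast
  \<comment> \<open>Strict positivity makes the radius \<open>1 / (2 * C)\<close> meaningful. On
    that disc \<open>C * cmod (z - z0)\<close> stays below 1/2, so the perturbed bound is at most
    \<open>2 * C\<close>.\<close>
  define C where "C = \<bar>B\<bar> + 1"
  have C: "0 < C" by (simp add: C_def)
  have bound: "norm u \<le> C * norm w" if "wr z0 u w" for u w
    using B[OF that] by (rule order_trans) (simp add: C_def mult_right_mono)
  have small: "C * cmod (z - z0) < 1 / 2" if "cmod (z - z0) < 1 / (2 * C)" for z
    using that C by (simp add: field_simps)
  have near: "norm u \<le> 2 * C * norm w" if z: "cmod (z - z0) < 1 / (2 * C)" and u: "wr z u w" for z u w
  proof -
    have "norm u \<le> C / (1 - C * cmod (z - z0)) * norm w"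
      using resolvent_perturb(2)[OF solv bound _ _ u] C small[OF z] by simp
    also have "\<dots> \<le> C / (1 / 2) * norm w"
      using small[OF z] C by (intro mult_right_mono divide_left_mono) auto
    finally show ?thesis by simp
  qed
  have "z \<in> resolvent_set (form_op_dom V a) (form_op V a)" if z: "cmod (z - z0) < 1 / (2 * C)" for z
    using resolvent_perturb(1)[OF solv bound, of z] C small[OF z] near[OF z]
    unfolding mem_resolvent_set_iff by fastforce
  then show ?thesis using that[of "1 / (2 * C)" "2 * C"] C near by simp
qed

text \<open>Testing the equation with \<open>u\<close> itself: the diagonal of the form is real and
  nonnegative, so the real and imaginary parts give one estimate each.\<close>

lemma weak_resolvent_rel_bounds:
  assumes "wr z u w"
  shows "- Re z * norm u \<le> norm w" "\<bar>Im z\<bar> * norm u \<le> norm w"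
proof -
  have u: "u \<in> V" and eq: "a u u - z * cinner u u = cinner w u"
    using assms by (auto simp: weak_resolvent_rel_def)
  have "Re (a u u) - Re z * (norm u)\<^sup>2 = Re (cinner w u)" "- Im z * (norm u)\<^sup>2 = Im (cinner w u)"
    using arg_cong[OF eq, of Re] arg_cong[OF eq, of Im] diag_Im[OF u] by (simp_all add: cinner_self)
  moreover have "Re (cinner w u) \<le> norm w * norm u" "\<bar>Im (cinner w u)\<bar> \<le> norm w * norm u"
    using cinner_Cauchy_Schwarz[of w u] complex_Re_le_cmod abs_Im_le_cmod order_trans by blast+
  moreover have "\<bar>Im z\<bar> * (norm u)\<^sup>2 = \<bar>- Im z * (norm u)\<^sup>2\<bar>" by (simp add: abs_mult)
  ultimately have *: "- Re z * norm u * norm u \<le> norm w * norm u"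
      "\<bar>Im z\<bar> * norm u * norm u \<le> norm w * norm u"
    using diag_nonneg[OF u] by (simp_all add: power2_eq_square mult.assoc)
  show "- Re z * norm u \<le> norm w" "\<bar>Im z\<bar> * norm u \<le> norm w"
    by (cases "u = 0", simp, rule mult_right_le_imp_le[OF *(1)], simp)
       (cases "u = 0", simp, rule mult_right_le_imp_le[OF *(2)], simp)
qed

text \<open>At -1 the weak equation says that \<open>u\<close> represents the functional of
  \<open>w\<close> in the form inner product, so Riesz gives solvability; the resolvent bound there
  is 1.\<close>

lemma minus_one_resolvent:
  "\<exists>u. wr (- 1) u w"
  "- 1 \<in> resolvent_set (form_op_dom V a) (form_op V a)"
proof -
  show *: "\<exists>u. wr (- 1) u w" for w
  proof (rule riesz[of "\<lambda>v. cinner w v" "norm w"])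
    show "cmod (cinner w v) \<le> norm w * form_norm a v" if "v \<in> V" for v
      using cinner_Cauchy_Schwarz[of w v] norm_le_form_norm[OF that]
      by (meson mult_left_mono norm_ge_zero order_trans)
  qed (auto simp: cinner_add_right cinner_scaleC_right weak_resolvent_rel_def)
  then show "- 1 \<in> resolvent_set (form_op_dom V a) (form_op V a)"
    unfolding mem_resolvent_set_iff using weak_resolvent_rel_bounds(1)[of "- 1"]
    by (auto intro!: exI[of _ 1])
qed

text \<open>
  A non-real \<open>x + \<i> y\<close> lies in the disc of radius \<open>s\<close> around \<open>-1 \<plusminus> \<i> s\<close> for large \<open>s\<close>, and
  \<open>-1 \<plusminus> \<i> s\<close> lies in the disc of radius \<open>t\<close> around \<open>-t\<close> for large \<open>t\<close>. In each case the
  radius is the reciprocal of the resolvent bound at the centre.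
\<close>

lemma nonreal_resolvent:
  assumes "z \<notin> \<real>"
  shows "z \<in> resolvent_set (form_op_dom V a) (form_op V a)"
proof -
  have step_Re: "\<exists>u. wr z u w"
    if t: "0 < t" and solv: "\<And>w. \<exists>u. wr (- complex_of_real t) u w"
      and z: "cmod (z + complex_of_real t) < t" for t z w
    using t z weak_resolvent_rel_bounds(1)[of "- complex_of_real t"]
    by (intro resolvent_perturb(1)[OF solv, of "1 / t"]) (auto simp: field_simps)
  have step_Im: "\<exists>u. wr z u w"
    if z0: "Im z0 \<noteq> 0" and solv: "\<And>w. \<exists>u. wr z0 u w" and z: "cmod (z - z0) < \<bar>Im z0\<bar>" for z z0 w
    using z0 z weak_resolvent_rel_bounds(2)[of z0]
    by (intro resolvent_perturb(1)[OF solv, of "1 / \<bar>Im z0\<bar>"]) (auto simp: field_simps)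
  \<comment> \<open>Passing from \<open>-t\<close> to \<open>-(3/2) t\<close> moves by
    \<open>t / 2\<close>, well inside the disc of radius \<open>t\<close>, so geometric steps from
    -1 reach arbitrarily large \<open>t\<close>.\<close>
  have real: "\<exists>u. wr (- complex_of_real ((3 / 2) ^ n)) u w" for n w
  proof (induction n arbitrary: w)
    case 0
    then show ?case using minus_one_resolvent(1) by simp
  next
    case (Suc n)
    have "cmod (- complex_of_real ((3 / 2) ^ Suc n) + complex_of_real ((3 / 2) ^ n)) < (3 / 2) ^ n"
    proof -
      have "- complex_of_real ((3 / 2) ^ Suc n) + complex_of_real ((3 / 2) ^ n)
          = complex_of_real (- ((3 / 2) ^ n / 2))" by simp
      then show ?thesis by (simp only: norm_of_real) simp
    qed
    then show ?case by (intro step_Re[OF _ Suc.IH]) auto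
  qed
  have line: "\<exists>u. wr (Complex (- 1) s) u w" for s w
  proof -
    \<comment> \<open>The squared distance of \<open>Complex (- 1) s\<close> from \<open>-t\<close>
      is \<open>t\<^sup>2 - 2 * t + 1 + s\<^sup>2\<close>, which is below \<open>t\<^sup>2\<close>
      once \<open>t\<close> exceeds \<open>1 + s\<^sup>2\<close>.\<close>
    obtain n where n: "1 + s\<^sup>2 < (3 / 2) ^ n" using real_arch_pow[of "3 / 2"] by auto
    define t :: real where "t = (3 / 2) ^ n"
    have t: "1 + s\<^sup>2 < t" "0 < t" using n by (simp_all add: t_def)
    have "(cmod (Complex (- 1) s + complex_of_real t))\<^sup>2 = (t - 1)\<^sup>2 + s\<^sup>2"
      by (simp add: cmod_power2)
    also have "\<dots> < t\<^sup>2" using t by (simp add: power2_diff)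
    finally have "cmod (Complex (- 1) s + complex_of_real t) < t"
      using t(2) by (rule power2_less_imp_less[OF _ less_imp_le])
    then show ?thesis by (rule step_Re[OF t(2) real[of n, folded t_def]])
  qed
  have Im: "Im z \<noteq> 0" using assms by (simp add: complex_is_Real_iff)
  have "\<exists>u. wr z u w" for w
  proof -
    \<comment> \<open>With \<open>P\<close> the numerator, the squared distance from
      \<open>z\<close> to \<open>Complex (- 1) s\<close> is
      \<open>P - 2 * s * Im z + s\<^sup>2\<close>. This choice makes it
      \<open>s\<^sup>2 - P\<close>, and \<open>s\<close> gets the sign of
      \<open>Im z\<close>.\<close>
    define s where "s = ((Re z + 1)\<^sup>2 + (Im z)\<^sup>2) / Im z"
    have "cmod (z - Complex (- 1) s) < \<bar>s\<bar>"
    proof (rule power2_less_imp_less)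
      have pos: "0 < (Re z + 1)\<^sup>2 + (Im z)\<^sup>2" using Im by (simp add: add_nonneg_pos)
      have "(cmod (z - Complex (- 1) s))\<^sup>2 = (Re z + 1)\<^sup>2 + (Im z)\<^sup>2 - 2 * (s * Im z) + s\<^sup>2"
        by (simp add: cmod_power2 power2_diff)
      also have "s * Im z = (Re z + 1)\<^sup>2 + (Im z)\<^sup>2" using Im by (simp add: s_def)
      finally show "(cmod (z - Complex (- 1) s))\<^sup>2 < \<bar>s\<bar>\<^sup>2" using pos by simp
    qed simp
    then show ?thesis
      using norm_ge_zero[of "z - Complex (- 1) s"] by (intro step_Im[OF _ line]) auto
  qed
  moreover have "norm u \<le> 1 / \<bar>Im z\<bar> * norm w" if "wr z u w" for u w
    using weak_resolvent_rel_bounds(2)[OF that] Im by (simp add: field_simps)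
  ultimately show ?thesis unfolding mem_resolvent_set_iff by blast
qed

end

section \<open>Boundary pairs\<close>

locale boundary_pair_of_form = closed_form D h
  for D :: "'h::complex_hilbert_space set" and h :: "'h form" +
  fixes \<Gamma> :: "'h \<Rightarrow> 'g::complex_hilbert_space"
  assumes boundary_pair: "boundary_pair D h \<Gamma>"
begin

abbreviation "D0 \<equiv> dirichlet_dom D \<Gamma>"
abbreviation "G \<equiv> \<Gamma> ` D"
abbreviation "S \<equiv> solution_map D h \<Gamma>"
abbreviation "dtn \<equiv> dtn_form D h \<Gamma>"
abbreviation "\<rho> \<equiv> resolvent_set (form_op_dom D0 h) (form_op D0 h)"

lemma trace_linear: "clinear_on D \<Gamma>"
  and trace_bounded: "\<exists>C. \<forall>u\<in>D. norm (\<Gamma> u) \<le> C * form_norm h u"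
  and dirichlet_dense: "closure D0 = UNIV"
  and trace_range_dense: "closure G = UNIV"
  using boundary_pair by (auto simp: boundary_pair_def)

lemma trace_zero: "\<Gamma> 0 = 0"
  using clinear_on_diff[OF trace_linear subspace csubspaceD(1)[OF subspace] csubspaceD(1)[OF subspace]]
  by simp

lemma dirichlet_subset: "v \<in> D0 \<Longrightarrow> v \<in> D"
  by (simp add: dirichlet_dom_def)

lemma dirichlet_subspace: "csubspace D0"
  using subspace trace_linear trace_zero
  by (auto simp: csubspace_def dirichlet_dom_def clinear_onD)

lemma diff_mem_dirichlet: "u \<in> D \<Longrightarrow> v \<in> D \<Longrightarrow> \<Gamma> u = \<Gamma> v \<Longrightarrow> u - v \<in> D0"
  by (simp add: dirichlet_dom_def csubspace_diff subspace clinear_on_diff[OF trace_linear subspace])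

text \<open>The trace is continuous in the form norm, so its kernel is closed there: the trace of
  the limit equals that of \<open>l - u n\<close>, which tends to 0.\<close>

lemma dirichlet_complete:
  assumes u: "\<And>n. u n \<in> D0"
    and Cauchy: "\<And>e. e > 0 \<Longrightarrow> \<exists>N. \<forall>m\<ge>N. \<forall>n\<ge>N. form_norm h (u m - u n) < e"
  shows "\<exists>l\<in>D0. (\<lambda>n. form_norm h (u n - l)) \<longlonglongrightarrow> 0"
proof -
  obtain l where l: "l \<in> D" "(\<lambda>n. form_norm h (u n - l)) \<longlonglongrightarrow> 0"
    using complete[OF dirichlet_subset[OF u] Cauchy] by blast
  obtain C where C: "\<And>u. u \<in> D \<Longrightarrow> norm (\<Gamma> u) \<le> C * form_norm h u" using trace_bounded by blast
  have le: "norm (\<Gamma> l) \<le> C * form_norm h (u n - l)" for n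
    using C[OF csubspace_diff[OF subspace dirichlet_subset[OF u] l(1)], of n] u[of n]
      clinear_on_diff[OF trace_linear subspace dirichlet_subset[OF u] l(1), of n]
    by (simp add: dirichlet_dom_def)
  have "(\<lambda>n. C * form_norm h (u n - l)) \<longlonglongrightarrow> C * 0"
    by (rule tendsto_mult[OF tendsto_const l(2)])
  then have "norm (\<Gamma> l) \<le> C * 0"
    by (rule LIMSEQ_le_const) (use le in blast)
  then show ?thesis using l by (auto simp: dirichlet_dom_def)
qed

lemma dirichlet_closed_form: "closed_nonneg_form D0 h"
proof -
  have "sesquilinear_on D0 h"
    using sesq dirichlet_subset unfolding sesquilinear_on_def by blast
  then show ?thesis
    unfolding closed_nonneg_form_def
    using dirichlet_subspace dirichlet_dense nonneg dirichlet_subset dirichlet_complete by blast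
qed

text \<open>The locale now serves twice: on \<open>D\<close> it provides the Neumann resolvent, on
  \<open>D0\<close> the Dirichlet one.\<close>

sublocale dirichlet: closed_form D0 h
  by unfold_locales (rule dirichlet_closed_form)

lemma mem_resolvent_iff: "z \<notin> dirichlet_spectrum D h \<Gamma> \<longleftrightarrow> z \<in> \<rho>"
  by (simp add: dirichlet_spectrum_def spectrum_def)

lemma trace_range_subspace: "csubspace G"
  unfolding csubspace_def
proof (intro conjI ballI allI)
  show "0 \<in> G" using trace_zero csubspaceD(1)[OF subspace] by (metis imageI)
  show "x + y \<in> G" if "x \<in> G" "y \<in> G" for x y
    using that clinear_onD(1)[OF trace_linear] csubspaceD(2)[OF subspace] by (smt (verit) imageE imageI)
  show "c *\<^sub>C x \<in> G" if "x \<in> G" for c x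
    using that clinear_onD(2)[OF trace_linear] csubspaceD(3)[OF subspace] by (smt (verit) imageE imageI)
qed

subsection \<open>Solution operators\<close>

abbreviation "sol \<equiv> weak_solutions D h \<Gamma>"

text \<open>The difference of two solutions with equal trace solves the homogeneous Dirichlet
  equation.\<close>

lemma weak_solutions_unique:
  assumes z: "z \<in> \<rho>" and "u \<in> sol z" "u' \<in> sol z" "\<Gamma> u = \<Gamma> u'"
  shows "u = u'"
proof -
  have "dirichlet.wr z (u - u') 0"
    using assms(2-4) dirichlet_subset
    by (auto simp: weak_resolvent_rel_def weak_solutions_def diff_mem_dirichlet cinner_diff_left
        sesquilinear_on_diff[OF sesq subspace] algebra_simps)
  moreover have "dirichlet.wr z 0 0"
    using dirichlet.weak_resolvent_rel_diff[OF calculation calculation] by simp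
  ultimately have "u - u' = 0" by (rule dirichlet.weak_resolvent_rel_unique[OF z])
  then show ?thesis by simp
qed

text \<open>At -1 weak solutions are the vectors orthogonal to \<open>D0\<close> in the form inner
  product, so the solution is \<open>f\<close> minus its projection \<open>g\<close> onto
  \<open>D0\<close>.\<close>

lemma weak_solutions_exist_minus_one:
  assumes f: "f \<in> D"
  shows "\<exists>u\<in>sol (- 1). \<Gamma> u = \<Gamma> f"
proof -
  obtain g where g: "g \<in> D0" "\<And>v. v \<in> D0 \<Longrightarrow> inner1 g v = inner1 f v"
  proof (rule dirichlet.riesz[of "inner1 f" "form_norm h f"])
    show "cmod (inner1 f x) \<le> form_norm h f * form_norm h x" if "x \<in> D0" for x
      using inner1_Cauchy_Schwarz[OF f dirichlet_subset[OF that]] .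
  qed (use sesquilinear_onD[OF inner1_sesq f] dirichlet_subset in auto)
  have "h (f - g) v = - 1 * cinner (f - g) v" if v: "v \<in> D0" for v
    unfolding cinner_diff_left
      sesquilinear_on_diff(1)[OF sesq subspace dirichlet_subset[OF v] f dirichlet_subset[OF g(1)]]
    using g(2)[OF v] by algebra
  then have "f - g \<in> sol (- 1)"
    using f dirichlet_subset[OF g(1)] by (simp add: weak_solutions_def csubspace_diff[OF subspace])
  moreover have "\<Gamma> (f - g) = \<Gamma> f"
    using clinear_on_diff[OF trace_linear subspace f dirichlet_subset[OF g(1)]] g(1)
    by (simp add: dirichlet_dom_def)
  ultimately show ?thesis by blast
qed

text \<open>The solution at -1 is corrected by the Dirichlet resolvent at \<open>z\<close> applied
  to its defect \<open>(z + 1) *\<^sub>C s\<close>; the correction has trace 0.\<close>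

lemma weak_solutions_exist:
  assumes z: "z \<in> \<rho>" and f: "f \<in> D"
  shows "\<exists>u\<in>sol z. \<Gamma> u = \<Gamma> f"
proof -
  obtain s where s: "s \<in> sol (- 1)" "\<Gamma> s = \<Gamma> f" using weak_solutions_exist_minus_one[OF f] by blast
  obtain g where g: "dirichlet.wr z g ((z + 1) *\<^sub>C s)"
    using z dirichlet.mem_resolvent_set_iff by blast
  have D: "s \<in> D" "g \<in> D0" using s g by (auto simp: weak_solutions_def weak_resolvent_rel_def)
  have "s + g \<in> sol z"
    unfolding weak_solutions_def
  proof (intro CollectI conjI ballI)
    show "s + g \<in> D" using D dirichlet_subset csubspaceD(2)[OF subspace] by blast
    fix v assume v: "v \<in> D0"
    have "h (s + g) v = h s v + h g v"
      using sesquilinear_onD(1)[OF sesq] v D dirichlet_subset by blast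
    moreover have "h s v = - cinner s v" using s v by (simp add: weak_solutions_def)
    moreover have "h g v - z * cinner g v = (z + 1) * cinner s v"
      using g v by (simp add: weak_resolvent_rel_def cinner_scaleC_left)
    ultimately show "h (s + g) v = z * cinner (s + g) v"
      by (simp add: cinner_add_left algebra_simps)
  qed
  moreover have "\<Gamma> (s + g) = \<Gamma> f"
    using clinear_onD(1)[OF trace_linear D(1) dirichlet_subset[OF D(2)]] D(2) s(2)
    by (simp add: dirichlet_dom_def)
  ultimately show ?thesis by blast
qed

lemma solution_map:
  assumes "z \<in> \<rho>" "\<phi> \<in> G"
  shows "S z \<phi> \<in> sol z" "\<Gamma> (S z \<phi>) = \<phi>" "S z \<phi> \<in> D"
    "f \<in> D0 \<Longrightarrow> h (S z \<phi>) f = z * cinner (S z \<phi>) f"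
proof -
  obtain g where g: "\<phi> = \<Gamma> g" "g \<in> D" using assms(2) by (rule imageE)
  obtain u where u: "u \<in> sol z" "\<Gamma> u = \<Gamma> g" using weak_solutions_exist[OF assms(1) g(2)] by (rule bexE)
  have *: "\<phi> \<in> \<Gamma> ` sol z" unfolding g(1) u(2)[symmetric] using u(1) by (rule imageI)
  show sol: "S z \<phi> \<in> sol z" unfolding solution_map_def by (rule inv_into_into[OF *])
  show "\<Gamma> (S z \<phi>) = \<phi>" unfolding solution_map_def by (rule f_inv_into_f[OF *])
  show "S z \<phi> \<in> D" "f \<in> D0 \<Longrightarrow> h (S z \<phi>) f = z * cinner (S z \<phi>) f"
    using sol by (auto simp: weak_solutions_def)
qed

lemma solution_map_eqI:
  assumes "z \<in> \<rho>" "u \<in> sol z" "\<Gamma> u = \<phi>"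
  shows "S z \<phi> = u"
proof -
  have "\<phi> \<in> G" using assms by (auto simp: weak_solutions_def)
  then show ?thesis
    using weak_solutions_unique[OF assms(1)] solution_map[OF assms(1)] assms(2,3) by metis
qed

lemma solution_map_linear:
  assumes z: "z \<in> \<rho>"
  shows "clinear_on G (S z)"
  unfolding clinear_on_def
proof (intro conjI ballI allI)
  fix \<phi> \<psi> assume \<phi>: "\<phi> \<in> G" and \<psi>: "\<psi> \<in> G"
  note s = solution_map[OF z \<phi>] solution_map[OF z \<psi>]
  show "S z (\<phi> + \<psi>) = S z \<phi> + S z \<psi>"
    using s clinear_onD(1)[OF trace_linear s(3) s(7)] csubspaceD(2)[OF subspace s(3) s(7)]
      sesquilinear_onD(1)[OF sesq _ s(3) s(7)] dirichlet_subset
    by (intro solution_map_eqI[OF z]) (auto simp: weak_solutions_def cinner_add_left algebra_simps)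
next
  fix \<phi> c assume \<phi>: "\<phi> \<in> G"
  note s = solution_map[OF z \<phi>]
  show "S z (c *\<^sub>C \<phi>) = c *\<^sub>C S z \<phi>"
    using s clinear_onD(2)[OF trace_linear s(3)] csubspaceD(3)[OF subspace s(3)]
      sesquilinear_onD(3)[OF sesq _ s(3)] dirichlet_subset
    by (intro solution_map_eqI[OF z]) (auto simp: weak_solutions_def cinner_scaleC_left)
qed

lemma solution_map_diff_resolvent:
  assumes z: "z \<in> \<rho>" and w: "w \<in> \<rho>" and \<phi>: "\<phi> \<in> G"
  shows "dirichlet.wr z (S z \<phi> - S w \<phi>) ((z - w) *\<^sub>C S w \<phi>)"
proof -
  note s = solution_map[OF z \<phi>] solution_map[OF w \<phi>]
  have "S z \<phi> - S w \<phi> \<in> D0" using s by (intro diff_mem_dirichlet) auto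
  moreover have "h (S z \<phi> - S w \<phi>) v - z * cinner (S z \<phi> - S w \<phi>) v = cinner ((z - w) *\<^sub>C S w \<phi>) v"
    if v: "v \<in> D0" for v
    using s(4)[OF v] s(8)[OF v] sesquilinear_on_diff(1)[OF sesq subspace dirichlet_subset[OF v] s(3,7)]
    by (simp add: cinner_diff_left cinner_scaleC_left algebra_simps)
  ultimately show ?thesis by (simp add: weak_resolvent_rel_def)
qed

text \<open>The bound is relative to \<open>norm (S w \<phi>)\<close>, hence uniform in
  \<open>\<phi>\<close> even when \<open>S w\<close> is unbounded on \<open>G\<close>.\<close>

lemma solution_map_locally_Lipschitz:
  assumes w: "w \<in> \<rho>"
  obtains d C where "0 < d" "0 \<le> C" "\<And>z. cmod (z - w) < d \<Longrightarrow> z \<in> \<rho>"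
    "\<And>z \<phi>. cmod (z - w) < d \<Longrightarrow> \<phi> \<in> G \<Longrightarrow>
      norm (S z \<phi> - S w \<phi>) \<le> C * cmod (z - w) * norm (S w \<phi>)"
proof -
  obtain d C where dC: "0 < d" "0 \<le> C" "\<And>z. cmod (z - w) < d \<Longrightarrow> z \<in> \<rho>"
      "\<And>z u f. cmod (z - w) < d \<Longrightarrow> dirichlet.wr z u f \<Longrightarrow> norm u \<le> C * norm f"
    using dirichlet.resolvent_locally_bounded[OF w] by blast
  have "norm (S z \<phi> - S w \<phi>) \<le> C * cmod (z - w) * norm (S w \<phi>)"
    if "cmod (z - w) < d" "\<phi> \<in> G" for z \<phi>
    using dC(4)[OF that(1) solution_map_diff_resolvent[OF dC(3)[OF that(1)] w that(2)]]
    by (simp add: norm_scaleC mult.assoc)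
  then show ?thesis using that dC by blast
qed

lemma solution_map_dominated:
  assumes z: "z \<in> \<rho>" and w: "w \<in> \<rho>"
  obtains C where "0 \<le> C" "\<And>\<phi>. \<phi> \<in> G \<Longrightarrow> norm (S z \<phi>) \<le> C * norm (S w \<phi>)"
proof -
  obtain B where B: "\<And>u f. dirichlet.wr z u f \<Longrightarrow> norm u \<le> B * norm f"
    using z dirichlet.mem_resolvent_set_iff by blast
  have "norm (S z \<phi>) \<le> (1 + \<bar>B\<bar> * cmod (z - w)) * norm (S w \<phi>)" if \<phi>: "\<phi> \<in> G" for \<phi>
  proof -
    have "norm (S z \<phi> - S w \<phi>) \<le> B * (cmod (z - w) * norm (S w \<phi>))"
      using B[OF solution_map_diff_resolvent[OF z w \<phi>]] by (simp add: norm_scaleC)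
    also have "\<dots> \<le> \<bar>B\<bar> * (cmod (z - w) * norm (S w \<phi>))" by (rule mult_right_mono) auto
    finally show ?thesis using norm_triangle_sub[of "S z \<phi>" "S w \<phi>"] by (simp add: algebra_simps)
  qed
  then show ?thesis using that[of "1 + \<bar>B\<bar> * cmod (z - w)"] by simp
qed

subsection \<open>Dirichlet-to-Neumann forms\<close>

text \<open>Two extensions of the same boundary value differ by an element of \<open>D0\<close>, on
  which the weak equation for \<open>S z \<phi>\<close> vanishes. Hence \<open>S(-1)\<close> in the
  second slot may be traded for any \<open>S w\<close>.\<close>

lemma dtn_form_extension_irrelevant:
  assumes z: "z \<in> \<rho>" and \<phi>: "\<phi> \<in> G" and f: "f \<in> D"
  shows "dtn z \<phi> (\<Gamma> f) = h (S z \<phi>) f - z * cinner (S z \<phi>) f"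
proof -
  note s = solution_map[OF dirichlet.minus_one_resolvent(2) imageI[OF f, of \<Gamma>]]
  have "S (- 1) (\<Gamma> f) - f \<in> D0" using s f by (intro diff_mem_dirichlet) auto
  from solution_map(4)[OF z \<phi> this] show ?thesis
    unfolding dtn_form_def
    using sesquilinear_on_diff(2)[OF sesq subspace solution_map(3)[OF z \<phi>] s(3) f]
    by (simp add: cinner_diff_right algebra_simps)
qed

text \<open>Each form is tested with the solution occurring in the other; the values of
  \<open>h\<close> are then conjugate to each other and cancel.\<close>

lemma dtn_form_diff_adjoint:
  assumes z: "z \<in> \<rho>" and w: "w \<in> \<rho>" and \<phi>: "\<phi> \<in> G" and \<psi>: "\<psi> \<in> G"
  shows "dtn z \<phi> \<psi> - cnj (dtn w \<psi> \<phi>) = (cnj w - z) * cinner (S z \<phi>) (S w \<psi>)"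
proof -
  note s = solution_map[OF z \<phi>] solution_map[OF w \<psi>]
  have "dtn z \<phi> \<psi> = h (S z \<phi>) (S w \<psi>) - z * cinner (S z \<phi>) (S w \<psi>)"
    using dtn_form_extension_irrelevant[OF z \<phi> s(7)] s(6) by simp
  moreover have "dtn w \<psi> \<phi> = h (S w \<psi>) (S z \<phi>) - w * cinner (S w \<psi>) (S z \<phi>)"
    using dtn_form_extension_irrelevant[OF w \<psi> s(3)] s(2) by simp
  then have "cnj (dtn w \<psi> \<phi>) = h (S z \<phi>) (S w \<psi>) - cnj w * cinner (S z \<phi>) (S w \<psi>)"
    by (simp add: hermitian[OF s(7) s(3)] cinner_commute[of "S z \<phi>" "S w \<psi>"])
  ultimately show ?thesis by (simp add: left_diff_distrib)
qed

lemma dtn_form_diff_real: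
  assumes "z \<in> \<rho>" "complex_of_real r \<in> \<rho>" "\<phi> \<in> G" "\<psi> \<in> G"
  shows "dtn z \<phi> \<psi> - dtn (complex_of_real r) \<phi> \<psi>
    = (complex_of_real r - z) * cinner (S z \<phi>) (S (complex_of_real r) \<psi>)"
  using dtn_form_diff_adjoint[OF assms] dtn_form_diff_adjoint[OF assms(2,2,3,4)] by simp

lemma dtn_form_minus_one:
  assumes \<phi>: "\<phi> \<in> G"
  shows "dtn (- 1) \<phi> \<phi> = complex_of_real ((boundary_norm D h \<Gamma> \<phi>)\<^sup>2)"
proof -
  note s = solution_map(3)[OF dirichlet.minus_one_resolvent(2) \<phi>]
  show ?thesis
    using s diag_Im[OF s]
    by (simp add: dtn_form_def boundary_norm_def form_norm_sq cinner_self complex_eq_iff)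
qed

lemma dtn_form_diff_minus_one:
  assumes "z \<in> \<rho>" "\<phi> \<in> G"
  shows "dtn z \<phi> \<phi>
    = complex_of_real ((boundary_norm D h \<Gamma> \<phi>)\<^sup>2) - (z + 1) * cinner (S z \<phi>) (S (- 1) \<phi>)"
  using dtn_form_diff_real[OF assms(1) _ assms(2,2), of "- 1"] dtn_form_minus_one[OF assms(2)]
    dirichlet.minus_one_resolvent(2)
  by (simp add: algebra_simps)

lemma Im_form_dtn_form:
  assumes "z \<in> \<rho>" "\<phi> \<in> G" "\<psi> \<in> G"
  shows "Im_form (dtn z) \<phi> \<psi> = - complex_of_real (Im z) * solution_form D h \<Gamma> z \<phi> \<psi>"
proof -
  have "cnj z - z = - complex_of_real (Im z) * (2 * \<i>)" by (simp add: complex_eq_iff)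
  then have "dtn z \<phi> \<psi> - cnj (dtn z \<psi> \<phi>)
      = - complex_of_real (Im z) * cinner (S z \<phi>) (S z \<psi>) * (2 * \<i>)"
    using dtn_form_diff_adjoint[OF assms(1,1,2,3)] by (simp only: mult_ac)
  then show ?thesis
    unfolding Im_form_def adjoint_form_def solution_form_def
    by (simp only:) (rule nonzero_mult_div_cancel_right, simp)
qed

text \<open>The difference quotient equals \<open>- cinner (S z \<phi>) (S r \<psi>)\<close>
  exactly, which reduces differentiability to continuity of \<open>S z \<phi>\<close> at
  \<open>r\<close>.\<close>

lemma dtn_form_has_derivative:
  assumes r: "complex_of_real r \<in> \<rho>" and \<phi>: "\<phi> \<in> G" and \<psi>: "\<psi> \<in> G"
  shows "((\<lambda>z. dtn z \<phi> \<psi>) has_field_derivative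
    - solution_form D h \<Gamma> (complex_of_real r) \<phi> \<psi>) (at (complex_of_real r))"
proof -
  let ?r = "complex_of_real r"
  obtain d C where dC: "0 < d" "0 \<le> C" "\<And>z. cmod (z - ?r) < d \<Longrightarrow> z \<in> \<rho>"
    "\<And>z \<phi>. cmod (z - ?r) < d \<Longrightarrow> \<phi> \<in> G \<Longrightarrow>
      norm (S z \<phi> - S ?r \<phi>) \<le> C * cmod (z - ?r) * norm (S ?r \<phi>)"
    using solution_map_locally_Lipschitz[OF r] by blast
  have near: "\<forall>\<^sub>F z in at ?r. cmod (z - ?r) < d \<and> z \<noteq> ?r"
    using dC(1) by (auto simp: eventually_at dist_norm)
  have g: "((\<lambda>z. C * cmod (z - ?r) * norm (S ?r \<phi>)) \<longlongrightarrow> 0) (at ?r)"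
    by (auto intro!: tendsto_eq_intros)
  have "((\<lambda>z. S z \<phi> - S ?r \<phi>) \<longlongrightarrow> 0) (at ?r)"
    by (rule Lim_null_comparison[OF _ g], rule eventually_mono[OF near]) (use dC(4) \<phi> in blast)
  then have "((\<lambda>z. S z \<phi>) \<longlongrightarrow> S ?r \<phi>) (at ?r)" by (rule LIM_zero_cancel)
  then have "((\<lambda>z. - cinner (S z \<phi>) (S ?r \<psi>)) \<longlongrightarrow> - cinner (S ?r \<phi>) (S ?r \<psi>)) (at ?r)"
    by (intro tendsto_minus tendsto_cinner tendsto_const)
  moreover have "\<forall>\<^sub>F z in at ?r.
      (dtn z \<phi> \<psi> - dtn ?r \<phi> \<psi>) / (z - ?r) = - cinner (S z \<phi>) (S ?r \<psi>)"
    by (rule eventually_mono[OF near])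
       (simp add: dtn_form_diff_real[OF dC(3) r \<phi> \<psi>] divide_simps, simp add: algebra_simps)
  ultimately show ?thesis
    unfolding has_field_derivative_iff solution_form_def
    using tendsto_cong[of "\<lambda>z. (dtn z \<phi> \<psi> - dtn ?r \<phi> \<psi>) / (z - ?r)"
        "\<lambda>z. - cinner (S z \<phi>) (S ?r \<psi>)" "at ?r"] by blast
qed

lemma dtn_form_deriv_eq:
  assumes "complex_of_real r \<in> \<rho>" "\<phi> \<in> G" "\<psi> \<in> G"
  shows "dtn_form_deriv D h \<Gamma> r \<phi> \<psi> = - solution_form D h \<Gamma> (complex_of_real r) \<phi> \<psi>"
  unfolding dtn_form_deriv_def by (rule DERIV_imp_deriv[OF dtn_form_has_derivative[OF assms]])

subsection \<open>Bounded solution operators\<close>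

definition bounded_solution_map :: "complex \<Rightarrow> bool"
  where "bounded_solution_map z \<longleftrightarrow> (\<exists>C. \<forall>\<phi>\<in>G. norm (S z \<phi>) \<le> C * norm \<phi>)"

lemma bounded_solution_mapI:
  assumes "\<And>\<phi>. \<phi> \<in> G \<Longrightarrow> (norm (S z \<phi>))\<^sup>2 \<le> C * (norm \<phi>)\<^sup>2"
  shows "bounded_solution_map z"
proof -
  have "norm (S z \<phi>) \<le> sqrt \<bar>C\<bar> * norm \<phi>" if "\<phi> \<in> G" for \<phi>
  proof (rule power2_le_imp_le)
    have "C * (norm \<phi>)\<^sup>2 \<le> \<bar>C\<bar> * (norm \<phi>)\<^sup>2" by (rule mult_right_mono) auto
    then show "(norm (S z \<phi>))\<^sup>2 \<le> (sqrt \<bar>C\<bar> * norm \<phi>)\<^sup>2"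
      using assms[OF that] by (simp add: power_mult_distrib)
  qed simp
  then show ?thesis unfolding bounded_solution_map_def by blast
qed

lemma bounded_solution_mapE:
  assumes "bounded_solution_map z"
  obtains C where "0 < C" "\<And>\<phi>. \<phi> \<in> G \<Longrightarrow> norm (S z \<phi>) \<le> C * norm \<phi>"
proof -
  obtain B where B: "\<And>\<phi>. \<phi> \<in> G \<Longrightarrow> norm (S z \<phi>) \<le> B * norm \<phi>"
    using assms unfolding bounded_solution_map_def by blast
  have "norm (S z \<phi>) \<le> (\<bar>B\<bar> + 1) * norm \<phi>" if "\<phi> \<in> G" for \<phi>
    using B[OF that] by (rule order_trans) (simp add: mult_right_mono)
  then show ?thesis using that[of "\<bar>B\<bar> + 1"] by simp
qed

lemma elliptically_regular_iff: "elliptically_regular D h \<Gamma> \<longleftrightarrow> bounded_solution_map (- 1)"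
proof
  assume "elliptically_regular D h \<Gamma>"
  then show "bounded_solution_map (- 1)"
    unfolding elliptically_regular_def using bounded_solution_mapI by blast
next
  assume "bounded_solution_map (- 1)"
  then obtain C where C: "0 < C" "\<And>\<phi>. \<phi> \<in> G \<Longrightarrow> norm (S (- 1) \<phi>) \<le> C * norm \<phi>"
    using bounded_solution_mapE by blast
  have "(norm (S (- 1) \<phi>))\<^sup>2 \<le> C\<^sup>2 * (norm \<phi>)\<^sup>2" if "\<phi> \<in> G" for \<phi>
    using power_mono[OF C(2)[OF that], of 2] by (simp add: power_mult_distrib)
  then show "elliptically_regular D h \<Gamma>"
    unfolding elliptically_regular_def using C(1) by blast
qed

lemma bounded_solution_map_transfer:
  assumes z: "z \<in> \<rho>" and w: "w \<in> \<rho>" and "bounded_solution_map w"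
  shows "bounded_solution_map z"
proof -
  obtain B where B: "0 < B" "\<And>\<phi>. \<phi> \<in> G \<Longrightarrow> norm (S w \<phi>) \<le> B * norm \<phi>"
    using assms(3) bounded_solution_mapE by blast
  obtain C where C: "0 \<le> C" "\<And>\<phi>. \<phi> \<in> G \<Longrightarrow> norm (S z \<phi>) \<le> C * norm (S w \<phi>)"
    using solution_map_dominated[OF z w] by blast
  have "norm (S z \<phi>) \<le> C * B * norm \<phi>" if \<phi>: "\<phi> \<in> G" for \<phi>
    using C(2)[OF \<phi>] mult_left_mono[OF B(2)[OF \<phi>] C(1)] by simp
  then show ?thesis unfolding bounded_solution_map_def by blast
qed

lemma elliptically_regular_iff_at:
  "z \<in> \<rho> \<Longrightarrow> elliptically_regular D h \<Gamma> \<longleftrightarrow> bounded_solution_map z"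
  unfolding elliptically_regular_iff
  using bounded_solution_map_transfer dirichlet.minus_one_resolvent(2) by blast

text \<open>Treats three forms at once: the extended solution form (\<open>c = 1\<close>), the
  imaginary part (\<open>c = - Im z\<close>) and the derivative (\<open>c = -1\<close>).\<close>

lemma form_bounded_on_scaled_solution_form:
  assumes "c \<noteq> 0" and q: "\<And>\<phi>. \<phi> \<in> G \<Longrightarrow> q \<phi> \<phi> = c * solution_form D h \<Gamma> z \<phi> \<phi>"
  shows "form_bounded_on G q \<longleftrightarrow> bounded_solution_map z"
proof -
  have eq: "cmod (q \<phi> \<phi>) = cmod c * (norm (S z \<phi>))\<^sup>2" if "\<phi> \<in> G" for \<phi>
    by (simp add: q[OF that] solution_form_def cinner_self norm_mult norm_power)
  show ?thesis
  proof
    assume "form_bounded_on G q"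
    then obtain C where "\<And>\<phi>. \<phi> \<in> G \<Longrightarrow> cmod c * (norm (S z \<phi>))\<^sup>2 \<le> C * (norm \<phi>)\<^sup>2"
      unfolding form_bounded_on_def using eq by metis
    then show "bounded_solution_map z"
      using assms(1) by (intro bounded_solution_mapI[of _ "C / cmod c"]) (simp add: field_simps)
  next
    assume "bounded_solution_map z"
    then obtain C where C: "0 < C" "\<And>\<phi>. \<phi> \<in> G \<Longrightarrow> norm (S z \<phi>) \<le> C * norm \<phi>"
      using bounded_solution_mapE by blast
    have "cmod (q \<phi> \<phi>) \<le> cmod c * C\<^sup>2 * (norm \<phi>)\<^sup>2" if "\<phi> \<in> G" for \<phi>
      using power_mono[OF C(2)[OF that], of 2] mult_left_mono[of "(norm (S z \<phi>))\<^sup>2" _ "cmod c"]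
      by (simp add: eq[OF that] power_mult_distrib mult.assoc)
    then show "form_bounded_on G q" unfolding form_bounded_on_def by blast
  qed
qed

lemma solution_form_op:
  assumes z: "z \<in> \<rho>" and "bounded_solution_map z"
  shows "form_assoc_bounded_op G (solution_form D h \<Gamma> z) (solution_form_op D h \<Gamma> z)"
proof -
  obtain C where C: "\<And>\<phi>. \<phi> \<in> G \<Longrightarrow> norm (S z \<phi>) \<le> C * norm \<phi>"
    using assms(2) bounded_solution_mapE by blast
  have "solution_form D h \<Gamma> z = (\<lambda>\<phi> \<psi>. cinner (S z \<phi>) (S z \<psi>))"
    by (intro ext) (simp add: solution_form_def)
  then obtain Q where Q: "form_assoc_bounded_op G (solution_form D h \<Gamma> z) Q"
    using ex_op_of_gram_form[OF trace_range_subspace trace_range_dense solution_map_linear[OF z] C]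
    by metis
  then show ?thesis
    unfolding solution_form_op_def
    by (rule theI[where a = Q]) (rule form_assoc_bounded_op_unique[OF trace_range_dense _ Q])
qed

lemma scaled_solution_form_op:
  assumes "z \<in> \<rho>" "bounded_solution_map z"
    and q: "\<And>\<phi> \<psi>. \<phi> \<in> G \<Longrightarrow> \<psi> \<in> G \<Longrightarrow> q \<phi> \<psi> = c * solution_form D h \<Gamma> z \<phi> \<psi>"
  shows "form_assoc_bounded_op G q (\<lambda>\<phi>. c *\<^sub>C solution_form_op D h \<Gamma> z \<phi>)"
proof -
  let ?Q = "solution_form_op D h \<Gamma> z"
  have Q: "bounded_op ?Q" "\<And>\<phi> \<psi>. \<phi> \<in> G \<Longrightarrow> \<psi> \<in> G \<Longrightarrow> solution_form D h \<Gamma> z \<phi> \<psi> = cinner (?Q \<phi>) \<psi>"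
    using solution_form_op[OF assms(1,2)] by (auto simp: form_assoc_bounded_op_def)
  obtain C where C: "\<And>x. norm (?Q x) \<le> C * norm x" using Q(1) by (auto simp: bounded_op_def)
  have "norm (c *\<^sub>C ?Q x) \<le> cmod c * C * norm x" for x
    using mult_left_mono[OF C[of x], of "cmod c"] by (simp add: norm_scaleC mult.assoc)
  moreover have "clinear_on UNIV (\<lambda>x. c *\<^sub>C ?Q x)"
    using Q(1) by (auto simp: bounded_op_def clinear_on_def scaleC_add_right scaleC_scaleC mult.commute)
  ultimately have "bounded_op (\<lambda>x. c *\<^sub>C ?Q x)" unfolding bounded_op_def by blast
  then show ?thesis by (simp add: form_assoc_bounded_op_def q Q(2) cinner_scaleC_left)
qed

text \<open>Once the operator \<open>?Q\<close> exists, its own form on the whole space serves as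
  the extension.\<close>

lemma solution_form_extends_iff:
  assumes z: "z \<in> \<rho>"
  shows "solution_form_extends D h \<Gamma> z \<longleftrightarrow> bounded_solution_map z"
proof
  assume "solution_form_extends D h \<Gamma> z"
  then obtain q where "form_bounded_on UNIV q"
      "\<And>\<phi>. \<phi> \<in> G \<Longrightarrow> q \<phi> \<phi> = 1 * solution_form D h \<Gamma> z \<phi> \<phi>"
    unfolding solution_form_extends_def by auto
  moreover from this(1) have "form_bounded_on G q" unfolding form_bounded_on_def by blast
  ultimately show "bounded_solution_map z"
    using form_bounded_on_scaled_solution_form[of 1 q z] by simp
next
  assume "bounded_solution_map z"
  let ?Q = "solution_form_op D h \<Gamma> z"
  have Q: "bounded_op ?Q" "\<And>\<phi> \<psi>. \<phi> \<in> G \<Longrightarrow> \<psi> \<in> G \<Longrightarrow> solution_form D h \<Gamma> z \<phi> \<psi> = cinner (?Q \<phi>) \<psi>"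
    using solution_form_op[OF z \<open>bounded_solution_map z\<close>] by (auto simp: form_assoc_bounded_op_def)
  obtain C where C: "\<And>x. norm (?Q x) \<le> C * norm x" and lin: "clinear_on UNIV ?Q"
    using Q(1) by (auto simp: bounded_op_def)
  have "cmod (cinner (?Q x) x) \<le> C * (norm x)\<^sup>2" for x
    using cinner_Cauchy_Schwarz[of "?Q x" x] mult_right_mono[OF C[of x], of "norm x"]
    by (simp add: power2_eq_square mult.assoc)
  then have "form_bounded_on UNIV (\<lambda>x y. cinner (?Q x) y)" unfolding form_bounded_on_def by blast
  moreover have "sesquilinear_on UNIV (\<lambda>x y. cinner (?Q x) y)"
    using lin by (simp add: sesquilinear_on_def clinear_on_def cinner_add_left cinner_add_right
        cinner_scaleC_left cinner_scaleC_right)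
  ultimately show "solution_form_extends D h \<Gamma> z"
    unfolding solution_form_extends_def
    using Q by (intro exI[of _ "\<lambda>x y. cinner (?Q x) y"]) (simp add: form_assoc_bounded_op_def)
qed

end

context boundary_pair_of_form
begin

subsection \<open>Ellipticity near \<open>-1\<close>\<close>

text \<open>With \<alpha> = 1 the squared boundary norm is exactly the value of the form at -1 and
  cancels, so ellipticity becomes a pure estimate on the remaining inner product.\<close>

lemma form_elliptic_dtn_form_iff:
  assumes z: "z \<in> \<rho>"
  shows "form_elliptic G (boundary_norm D h \<Gamma>) (dtn z) 1 \<omega> \<longleftrightarrow>
    (\<forall>\<phi>\<in>G. Re ((z + 1) * cinner (S z \<phi>) (S (- 1) \<phi>)) \<le> \<omega> * (norm \<phi>)\<^sup>2)"
proof -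
  have "Re (Re_form (dtn z) \<phi> \<phi>)
      = (boundary_norm D h \<Gamma> \<phi>)\<^sup>2 - Re ((z + 1) * cinner (S z \<phi>) (S (- 1) \<phi>))"
    if "\<phi> \<in> G" for \<phi>
  proof -
    have "Re (Re_form (dtn z) \<phi> \<phi>) = Re (dtn z \<phi> \<phi>)"
      by (simp add: Re_form_def adjoint_form_def)
    then show ?thesis
      by (simp only: dtn_form_diff_minus_one[OF z that] minus_complex.simps Re_complex_of_real)
  qed
  then show ?thesis unfolding form_elliptic_def by (intro ball_cong) auto
qed

lemma ex_elliptic_constant:
  assumes "bounded_solution_map (- 1)"
  obtains \<omega> where "ellipticity_rate (\<lambda>a. \<omega> (complex_of_real a))"
    "\<And>z. z \<in> \<rho> \<Longrightarrow> form_elliptic G (boundary_norm D h \<Gamma>) (dtn z) 1 (\<omega> z)"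
proof -
  obtain B where B: "0 < B" "\<And>\<phi>. \<phi> \<in> G \<Longrightarrow> norm (S (- 1) \<phi>) \<le> B * norm \<phi>"
    using assms bounded_solution_mapE by blast
  obtain d C where dC: "0 < d" "0 \<le> C" "\<And>z. cmod (z - (- 1)) < d \<Longrightarrow> z \<in> \<rho>"
    "\<And>z \<phi>. cmod (z - (- 1)) < d \<Longrightarrow> \<phi> \<in> G \<Longrightarrow>
      norm (S z \<phi> - S (- 1) \<phi>) \<le> C * cmod (z - (- 1)) * norm (S (- 1) \<phi>)"
    using solution_map_locally_Lipschitz[OF dirichlet.minus_one_resolvent(2)] by blast
  have "\<exists>c\<ge>0. \<forall>\<phi>\<in>G. norm (S z \<phi>) \<le> c * norm (S (- 1) \<phi>)" if "z \<in> \<rho>" for z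
    using solution_map_dominated[OF that dirichlet.minus_one_resolvent(2)] by metis
  then obtain c' where c': "\<And>z. z \<in> \<rho> \<Longrightarrow> 0 \<le> c' z"
    "\<And>z \<phi>. z \<in> \<rho> \<Longrightarrow> \<phi> \<in> G \<Longrightarrow> norm (S z \<phi>) \<le> c' z * norm (S (- 1) \<phi>)"
    by metis
  \<comment> \<open>The chosen constants \<open>c'\<close> carry no uniformity in \<open>z\<close>.
    Near -1 they are replaced by the Lipschitz constant plus 1, so that \<open>c\<close> stays
    bounded there.\<close>
  define c where "c z = (if cmod (z - (- 1)) < d then 1 + C * d else c' z)" for z
  have c: "0 \<le> c z" "norm (S z \<phi>) \<le> c z * norm (S (- 1) \<phi>)" if z: "z \<in> \<rho>" and \<phi>: "\<phi> \<in> G" for z \<phi>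
  proof -
    show "0 \<le> c z" using c'(1)[OF z] dC(1,2) by (simp add: c_def)
    show "norm (S z \<phi>) \<le> c z * norm (S (- 1) \<phi>)"
    proof (cases "cmod (z - (- 1)) < d")
      case True
      have "norm (S z \<phi> - S (- 1) \<phi>) \<le> C * d * norm (S (- 1) \<phi>)"
        using dC(4)[OF True \<phi>]
          mult_right_mono[OF mult_left_mono[OF less_imp_le[OF True] dC(2)], of "norm (S (- 1) \<phi>)"]
        by simp
      then show ?thesis
        using norm_triangle_sub[of "S z \<phi>" "S (- 1) \<phi>"] True by (simp add: c_def algebra_simps)
    next
      case False
      then show ?thesis using c'(2)[OF z \<phi>] by (simp add: c_def)
    qed
  qed
  \<comment> \<open>The factor \<open>cmod (z + 1)\<close> yields both the zero at -1 and a bounded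
    quotient nearby.\<close>
  define \<omega> where "\<omega> z = cmod (z + 1) * c z * B\<^sup>2" for z
  have "form_elliptic G (boundary_norm D h \<Gamma>) (dtn z) 1 (\<omega> z)" if z: "z \<in> \<rho>" for z
    unfolding form_elliptic_dtn_form_iff[OF z]
  proof
    fix \<phi> assume \<phi>: "\<phi> \<in> G"
    have "Re ((z + 1) * cinner (S z \<phi>) (S (- 1) \<phi>)) \<le> cmod (z + 1) * cmod (cinner (S z \<phi>) (S (- 1) \<phi>))"
      unfolding norm_mult[symmetric] by (rule complex_Re_le_cmod)
    also have "\<dots> \<le> cmod (z + 1) * (c z * (norm (S (- 1) \<phi>))\<^sup>2)"
    proof (rule mult_left_mono)
      have "cmod (cinner (S z \<phi>) (S (- 1) \<phi>)) \<le> norm (S z \<phi>) * norm (S (- 1) \<phi>)"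
        by (rule cinner_Cauchy_Schwarz)
      also have "\<dots> \<le> c z * norm (S (- 1) \<phi>) * norm (S (- 1) \<phi>)"
        using c(2)[OF z \<phi>] by (rule mult_right_mono) simp
      finally show "cmod (cinner (S z \<phi>) (S (- 1) \<phi>)) \<le> c z * (norm (S (- 1) \<phi>))\<^sup>2"
        by (simp add: power2_eq_square mult.assoc)
    qed simp
    also have "\<dots> \<le> cmod (z + 1) * (c z * (B * norm \<phi>)\<^sup>2)"
      by (intro mult_left_mono power_mono B(2) \<phi> c(1)[OF z \<phi>]) auto
    finally show "Re ((z + 1) * cinner (S z \<phi>) (S (- 1) \<phi>)) \<le> \<omega> z * (norm \<phi>)\<^sup>2"
      by (simp add: \<omega>_def power_mult_distrib mult_ac)
  qed
  moreover have "ellipticity_rate (\<lambda>a. \<omega> (complex_of_real a))"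
  proof -
    define M where "M = (1 + C * d) * B\<^sup>2"
    have M: "\<bar>1 + C * d\<bar> = 1 + C * d" using dC(1,2) by simp
    have abs_eq: "cmod (complex_of_real a + 1) = \<bar>a + 1\<bar>" for a
      by (metis norm_of_real of_real_1 of_real_add)
    \<comment> \<open>For real \<open>a\<close> different from -1 the quotient is \<open>M\<close>
      or \<open>- M\<close> according to the sign of \<open>a + 1\<close>; it has no limit at -1,
      but its limsup is finite. At -1 itself division by 0 gives 0.\<close>
    have "\<bar>\<omega> (complex_of_real a) / (a + 1)\<bar> \<le> M" if "\<bar>a + 1\<bar> < d" for a
      using that abs_eq[of a] dC(1,2)
      by (cases "a + 1 = 0") (simp_all add: \<omega>_def c_def M_def abs_mult M mult_ac)
    then have near: "\<forall>\<^sub>F a in at (- 1). \<bar>\<omega> (complex_of_real a) / (a + 1)\<bar> \<le> M"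
      using dC(1) by (auto simp: eventually_at dist_norm)
    have "Limsup (at (- 1)) (\<lambda>a. ereal (\<omega> (complex_of_real a) / (a + 1))) \<le> ereal M"
      by (rule Limsup_bounded, rule eventually_mono[OF near])
         (simp only: ereal_less_eq abs_le_iff)
    moreover have "ereal (- M) \<le> Limsup (at (- 1)) (\<lambda>a. ereal (\<omega> (complex_of_real a) / (a + 1)))"
      by (rule le_Limsup, simp, rule eventually_mono[OF near])
         (unfold ereal_less_eq abs_le_iff, linarith)
    ultimately have "\<bar>Limsup (at (- 1)) (\<lambda>a. ereal (\<omega> (complex_of_real a) / (a + 1)))\<bar> \<noteq> \<infinity>"
      by auto
    then show ?thesis by (simp add: ellipticity_rate_def \<omega>_def)
  qed
  ultimately show ?thesis using that by blast
qed

lemma eventually_real_resolvent: "\<forall>\<^sub>F a in nhds (- 1). complex_of_real a \<in> \<rho>"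
proof -
  obtain d where d: "0 < d" "\<And>z. cmod (z - (- 1)) < d \<Longrightarrow> z \<in> \<rho>"
    by (rule dirichlet.resolvent_locally_bounded[OF dirichlet.minus_one_resolvent(2)])
       (rule that, assumption, blast)
  have "complex_of_real a \<in> \<rho>" if "dist a (- 1) < d" for a
  proof (rule d(2))
    have "complex_of_real a - (- 1) = complex_of_real (a + 1)" by simp
    then show "cmod (complex_of_real a - (- 1)) < d"
      using that by (simp only: norm_of_real) (simp add: dist_real_def)
  qed
  then show ?thesis using d(1) by (auto simp: eventually_nhds_metric)
qed

text \<open>A single real parameter slightly above \<open>-1\<close> suffices, because there \<open>S(a)\<close> is close to \<open>S(-1)\<close>.\<close>

lemma bounded_solution_map_if_elliptic:
  assumes rate: "ellipticity_rate \<omega>"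
    and ell: "\<forall>\<^sub>F a in nhds (- 1).
      form_elliptic G (boundary_norm D h \<Gamma>) (dtn (complex_of_real a)) 1 (\<omega> a)"
  shows "bounded_solution_map (- 1)"
proof -
  obtain d C where dC: "0 < d" "0 \<le> C" "\<And>z. cmod (z - (- 1)) < d \<Longrightarrow> z \<in> \<rho>"
    "\<And>z \<phi>. cmod (z - (- 1)) < d \<Longrightarrow> \<phi> \<in> G \<Longrightarrow>
      norm (S z \<phi> - S (- 1) \<phi>) \<le> C * cmod (z - (- 1)) * norm (S (- 1) \<phi>)"
    using solution_map_locally_Lipschitz[OF dirichlet.minus_one_resolvent(2)] by blast
  let ?L = "Limsup (at (- 1)) (\<lambda>a. ereal (\<omega> a / (a + 1)))"
  obtain l where l: "?L = ereal l"
    using rate unfolding ellipticity_rate_def by (cases ?L) auto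
  have "\<forall>\<^sub>F a in at (- 1). ereal (\<omega> a / (a + 1)) < ereal (l + 1)"
    by (rule Limsup_lessD) (simp add: l)
  \<comment> \<open>Only the right side is kept: there \<open>a + 1\<close> is positive, so an upper
    bound on the quotient is an upper bound on \<open>\<omega> a\<close>.\<close>
  then have "\<forall>\<^sub>F a in at_right (- 1). \<omega> a / (a + 1) < l + 1"
    by (auto simp: eventually_at_split)
  moreover have "\<forall>\<^sub>F a in at_right (- 1).
      form_elliptic G (boundary_norm D h \<Gamma>) (dtn (complex_of_real a)) 1 (\<omega> a)"
    using ell by (simp add: eventually_nhds_conv_at eventually_at_split)
  \<comment> \<open>The first bound keeps \<open>a\<close> where the Lipschitz estimate holds, the
    second forces \<open>C * (a + 1) \<le> 1 / 2\<close>; \<open>C + 1\<close> avoids division by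
    0.\<close>
  moreover have "\<forall>\<^sub>F a in at_right (- 1). a \<in> {- 1<..<- 1 + min d (1 / (2 * (C + 1)))}"
    using dC(1,2) by (intro eventually_at_right_real) simp
  ultimately have "\<forall>\<^sub>F a in at_right (- 1). \<omega> a / (a + 1) < l + 1 \<and>
      form_elliptic G (boundary_norm D h \<Gamma>) (dtn (complex_of_real a)) 1 (\<omega> a) \<and>
      a \<in> {- 1<..<- 1 + min d (1 / (2 * (C + 1)))}"
    by (intro eventually_conj)
  from eventually_happens[OF this] obtain a where "\<omega> a / (a + 1) < l + 1"
      "form_elliptic G (boundary_norm D h \<Gamma>) (dtn (complex_of_real a)) 1 (\<omega> a)"
      "a \<in> {- 1<..<- 1 + min d (1 / (2 * (C + 1)))}"
    by (metis trivial_limit_at_right_real)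
  then have a: "\<omega> a / (a + 1) < l + 1"
      "form_elliptic G (boundary_norm D h \<Gamma>) (dtn (complex_of_real a)) 1 (\<omega> a)"
      "- 1 < a" "a + 1 < d" "a + 1 < 1 / (2 * (C + 1))"
    by (simp_all only: greaterThanLessThan_iff) linarith+
  have dist: "cmod (complex_of_real a - (- 1)) = a + 1"
  proof -
    have "complex_of_real a - (- 1) = complex_of_real (a + 1)" by simp
    then show ?thesis using a(3) by (simp only: norm_of_real)
  qed
  have \<rho>: "complex_of_real a \<in> \<rho>" using dC(3) dist a(4) by simp
  have small: "C * (a + 1) \<le> 1 / 2"
  proof -
    have "(C + 1) * (a + 1) < 1 / 2" using a(5) dC(2) by (simp add: field_simps)
    then show ?thesis using a(3) by (simp add: algebra_simps)
  qed
  show ?thesis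
  proof (rule bounded_solution_mapI)
    fix \<phi> assume \<phi>: "\<phi> \<in> G"
    let ?s = "S (- 1) \<phi>" and ?a = "complex_of_real a"
    have "norm (S ?a \<phi> - ?s) \<le> (C * (a + 1)) * norm ?s"
      using dC(4)[of ?a \<phi>] dist a(4) \<phi> by simp
    also have "\<dots> \<le> 1 / 2 * norm ?s" using small by (rule mult_right_mono) simp
    finally have near: "norm (S ?a \<phi> - ?s) \<le> 1 / 2 * norm ?s" .
    \<comment> \<open>\<open>S ?a \<phi>\<close> is within half the norm of \<open>?s\<close> from
      \<open>?s\<close>, so their inner product has real part at least half of the squared norm of
      \<open>?s\<close>.\<close>
    have "- Re (cinner (S ?a \<phi> - ?s) ?s) \<le> norm (S ?a \<phi> - ?s) * norm ?s"
      using cinner_Cauchy_Schwarz[of "S ?a \<phi> - ?s" ?s] abs_Re_le_cmod[of "cinner (S ?a \<phi> - ?s) ?s"] by linarith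
    also have "\<dots> \<le> 1 / 2 * norm ?s * norm ?s" using near by (rule mult_right_mono) simp
    finally have lower: "1 / 2 * (norm ?s)\<^sup>2 \<le> Re (cinner (S ?a \<phi>) ?s)"
      by (simp add: cinner_diff_left cinner_self power2_eq_square)
    have "(a + 1) * Re (cinner (S ?a \<phi>) ?s) = Re ((?a + 1) * cinner (S ?a \<phi>) ?s)" by simp
    also have "\<dots> \<le> \<omega> a * (norm \<phi>)\<^sup>2"
      using a(2) \<phi> unfolding form_elliptic_dtn_form_iff[OF \<rho>] by blast
    also have "\<dots> \<le> (a + 1) * (l + 1) * (norm \<phi>)\<^sup>2"
      using a(1,3) by (intro mult_right_mono) (simp_all add: field_simps)
    finally have "Re (cinner (S ?a \<phi>) ?s) \<le> (l + 1) * (norm \<phi>)\<^sup>2"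
      using a(3) by (simp add: mult.assoc)
    then show "(norm ?s)\<^sup>2 \<le> 2 * (l + 1) * (norm \<phi>)\<^sup>2"
      using lower unfolding mult.assoc by linarith
  qed
qed

subsection \<open>The Neumann resolvent\<close>

abbreviation "R \<equiv> neumann_resolvent D h"

text \<open>Solvability at -1 puts \<open>w\<close> in the range that \<open>inv_into\<close>
  inverts; from here on \<open>R\<close> is used through this relation.\<close>

lemma neumann_resolvent_rel: "wr (- 1) (R w) w"
proof -
  obtain u where u: "wr (- 1) u w" using minus_one_resolvent(1) by blast
  then have "w \<in> (\<lambda>u. neumann_op D h u + u) ` neumann_dom D h"
    unfolding weak_resolvent_rel_iff neumann_dom_def neumann_op_def
    by (auto simp: scaleC_minus_one)
  from inv_into_into[OF this] f_inv_into_f[OF this] show ?thesis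
    unfolding weak_resolvent_rel_iff neumann_resolvent_def
    by (auto simp: scaleC_minus_one neumann_dom_def neumann_op_def)
qed

lemma neumann_dom_eq_range: "neumann_dom D h = range R"
proof
  show "range R \<subseteq> neumann_dom D h"
    using neumann_resolvent_rel unfolding weak_resolvent_rel_iff neumann_dom_def by blast
  show "neumann_dom D h \<subseteq> range R"
  proof
    fix u assume "u \<in> neumann_dom D h"
    then have "wr (- 1) u (form_op D h u - (- 1) *\<^sub>C u)"
      unfolding weak_resolvent_rel_iff neumann_dom_def by simp
    from weak_resolvent_rel_unique[OF minus_one_resolvent(2) this neumann_resolvent_rel]
    show "u \<in> range R" by (rule range_eqI)
  qed
qed

text \<open>This identifies \<open>\<Lambda> \<Gamma> R\<close> with the adjoint of \<open>S\<close>.\<close>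

lemma dtn_form_trace_resolvent:
  assumes \<psi>: "\<psi> \<in> G"
  shows "dtn (- 1) (\<Gamma> (R w)) \<psi> = cinner w (S (- 1) \<psi>)"
proof -
  let ?u = "R w"
  have u: "?u \<in> D" and eq: "\<And>v. v \<in> D \<Longrightarrow> inner1 ?u v = cinner w v"
    using neumann_resolvent_rel[of w] by (auto simp: weak_resolvent_rel_def)
  note m = dirichlet.minus_one_resolvent(2) and s = solution_map(3)[OF dirichlet.minus_one_resolvent(2) \<psi>]
  have "dtn (- 1) (\<Gamma> ?u) \<psi> = cnj (dtn (- 1) \<psi> (\<Gamma> ?u))"
    using dtn_form_diff_adjoint[OF m m _ \<psi>, of "\<Gamma> ?u"] u by simp
  also have "dtn (- 1) \<psi> (\<Gamma> ?u) = inner1 (S (- 1) \<psi>) ?u"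
    using dtn_form_extension_irrelevant[OF m \<psi> u] by simp
  also have "cnj \<dots> = inner1 ?u (S (- 1) \<psi>)"
    by (simp add: hermitian[OF s u] cinner_commute[of ?u "S (- 1) \<psi>"])
  finally show ?thesis using eq[OF s] by simp
qed

text \<open>The adjoint \<open>T\<close> of \<open>S (- 1)\<close> has the defining property of the
  operator value at \<open>\<Gamma> (R w)\<close>, so domain membership and boundedness come from
  the same operator.\<close>

lemma dtn_op_trace_resolvent:
  assumes "bounded_solution_map (- 1)"
  shows "\<Gamma> (R w) \<in> dtn_op_dom D h \<Gamma>" "bounded_op (\<lambda>w. dtn_op D h \<Gamma> (\<Gamma> (R w)))"
proof -
  obtain C where C: "\<And>\<phi>. \<phi> \<in> G \<Longrightarrow> norm (S (- 1) \<phi>) \<le> C * norm \<phi>"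
    using assms bounded_solution_mapE by blast
  obtain T where T: "bounded_op T" "\<And>w \<psi>. \<psi> \<in> G \<Longrightarrow> cinner (T w) \<psi> = cinner w (S (- 1) \<psi>)"
    using ex_adjoint[OF trace_range_subspace trace_range_dense
        solution_map_linear[OF dirichlet.minus_one_resolvent(2)] C] by blast
  have mem: "\<Gamma> (R w) \<in> G" for w
    using neumann_resolvent_rel[of w] by (simp add: weak_resolvent_rel_def)
  have eq: "dtn (- 1) (\<Gamma> (R w)) \<psi> = cinner (T w) \<psi>" if "\<psi> \<in> G" for w \<psi>
    using dtn_form_trace_resolvent[OF that] T(2)[OF that] by simp
  note op = form_op_eqI[where a = "dtn (- 1)", OF trace_range_dense mem eq]
  show "\<Gamma> (R w) \<in> dtn_op_dom D h \<Gamma>"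
    unfolding dtn_op_dom_def by (rule op(1))
  have "(\<lambda>w. dtn_op D h \<Gamma> (\<Gamma> (R w))) = T"
    unfolding dtn_op_def by (intro ext op(2))
  then show "bounded_op (\<lambda>w. dtn_op D h \<Gamma> (\<Gamma> (R w)))" using T(1) by simp
qed

text \<open>Membership of \<open>\<Gamma> (R w)\<close> in the operator domain says that pairing
  \<open>w\<close> with \<open>S (- 1)\<close> is bounded on the unit ball of \<open>G\<close>. For
  all \<open>w\<close> together, the image of that ball is weakly bounded, hence bounded.\<close>

lemma bounded_solution_map_if_trace_in_dtn_dom:
  assumes "\<And>w. \<Gamma> (R w) \<in> dtn_op_dom D h \<Gamma>"
  shows "bounded_solution_map (- 1)"
proof -
  let ?X = "S (- 1) ` {\<psi> \<in> G. norm \<psi> \<le> 1}"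
  have "\<exists>C. \<forall>x\<in>?X. cmod (cinner w x) \<le> C" for w
  proof -
    obtain \<eta> where \<eta>: "\<And>\<psi>. \<psi> \<in> G \<Longrightarrow> dtn (- 1) (\<Gamma> (R w)) \<psi> = cinner \<eta> \<psi>"
      using assms[of w] unfolding dtn_op_dom_def form_op_dom_def by blast
    have "cmod (cinner w (S (- 1) \<psi>)) \<le> norm \<eta>" if "\<psi> \<in> G" "norm \<psi> \<le> 1" for \<psi>
      using cinner_Cauchy_Schwarz[of \<eta> \<psi>] mult_left_mono[OF that(2), of "norm \<eta>"]
      by (simp add: dtn_form_trace_resolvent[OF that(1), symmetric] \<eta>[OF that(1)])
    then show ?thesis by blast
  qed
  then obtain C where C: "\<And>\<psi>. \<psi> \<in> G \<Longrightarrow> norm \<psi> \<le> 1 \<Longrightarrow> norm (S (- 1) \<psi>) \<le> C"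
    using weakly_bounded_imp_bounded[of ?X] by blast
  have lin: "S (- 1) (c *\<^sub>C \<phi>) = c *\<^sub>C S (- 1) \<phi>" if "\<phi> \<in> G" for c \<phi>
    using clinear_onD(2)[OF solution_map_linear[OF dirichlet.minus_one_resolvent(2)] that] .
  have "norm (S (- 1) \<phi>) \<le> C * norm \<phi>" if \<phi>: "\<phi> \<in> G" for \<phi>
  proof (cases "\<phi> = 0")
    case True
    then show ?thesis using lin[OF \<phi>, of 0] by simp
  next
    case False
    let ?c = "complex_of_real (1 / norm \<phi>)"
    have c: "cmod ?c = 1 / norm \<phi>" by (simp only: norm_of_real) simp
    have "norm (?c *\<^sub>C \<phi>) \<le> 1" using False by (simp add: norm_scaleC c del: of_real_divide)
    then have "norm (S (- 1) (?c *\<^sub>C \<phi>)) \<le> C"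
      using C csubspaceD(3)[OF trace_range_subspace \<phi>] by blast
    then show ?thesis
      unfolding lin[OF \<phi>] norm_scaleC c using False by (simp add: field_simps)
  qed
  then show ?thesis unfolding bounded_solution_map_def by blast
qed

end

section \<open>Equivalence of the regularity criteria\<close>

theorem theorem3p5:
  fixes D :: "'h::complex_hilbert_space set"
    and h :: "'h \<Rightarrow> 'h \<Rightarrow> complex"
    and \<Gamma> :: "'h \<Rightarrow> 'g::complex_hilbert_space"
  assumes "closed_nonneg_form D h"
    and "boundary_pair D h \<Gamma>"
  shows
    \<comment> \<open>(i) iff (ii), some and any version\<close>
    "(elliptically_regular D h \<Gamma> \<longleftrightarrow>
       (\<exists>z. z \<notin> dirichlet_spectrum D h \<Gamma> \<and> solution_form_extends D h \<Gamma> z)) \<and>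
     (elliptically_regular D h \<Gamma> \<longleftrightarrow>
       (\<forall>z. z \<notin> dirichlet_spectrum D h \<Gamma> \<longrightarrow> solution_form_extends D h \<Gamma> z)) \<and>
     \<comment> \<open>(i) iff (iii), some and any version\<close>
     (elliptically_regular D h \<Gamma> \<longleftrightarrow>
       (\<exists>z. z \<notin> \<real> \<and> form_bounded_on (\<Gamma> ` D) (Im_form (dtn_form D h \<Gamma> z)))) \<and>
     (elliptically_regular D h \<Gamma> \<longleftrightarrow>
       (\<forall>z. z \<notin> \<real> \<longrightarrow> form_bounded_on (\<Gamma> ` D) (Im_form (dtn_form D h \<Gamma> z)))) \<and>
     \<comment> \<open>the supplements of (iii)\<close>
     (\<forall>z. z \<notin> \<real> \<longrightarrow>
       (\<forall>\<phi>\<in>\<Gamma> ` D. \<forall>\<psi>\<in>\<Gamma> ` D.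
          Im_form (dtn_form D h \<Gamma> z) \<phi> \<psi> =
          - complex_of_real (Im z) * solution_form D h \<Gamma> z \<phi> \<psi>)) \<and>
     (\<forall>z. z \<notin> \<real> \<and> form_bounded_on (\<Gamma> ` D) (Im_form (dtn_form D h \<Gamma> z)) \<longrightarrow>
       form_assoc_bounded_op (\<Gamma> ` D) (Im_form (dtn_form D h \<Gamma> z))
         (\<lambda>\<phi>. (- complex_of_real (Im z)) *\<^sub>C solution_form_op D h \<Gamma> z \<phi>)) \<and>
     \<comment> \<open>(i) iff (iv), some and any version\<close>
     (elliptically_regular D h \<Gamma> \<longleftrightarrow>
       (\<exists>r. complex_of_real r \<notin> dirichlet_spectrum D h \<Gamma> \<and>
            form_bounded_on (\<Gamma> ` D) (dtn_form_deriv D h \<Gamma> r))) \<and>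
     (elliptically_regular D h \<Gamma> \<longleftrightarrow>
       (\<forall>r. complex_of_real r \<notin> dirichlet_spectrum D h \<Gamma> \<longrightarrow>
            form_bounded_on (\<Gamma> ` D) (dtn_form_deriv D h \<Gamma> r))) \<and>
     \<comment> \<open>the supplement of (iv)\<close>
     (\<forall>r. complex_of_real r \<notin> dirichlet_spectrum D h \<Gamma> \<and>
          form_bounded_on (\<Gamma> ` D) (dtn_form_deriv D h \<Gamma> r) \<longrightarrow>
       form_assoc_bounded_op (\<Gamma> ` D) (dtn_form_deriv D h \<Gamma> r)
         (\<lambda>\<phi>. - solution_form_op D h \<Gamma> (complex_of_real r) \<phi>)) \<and>
     \<comment> \<open>(i) iff (v), local real version and global complex version\<close>
     (elliptically_regular D h \<Gamma> \<longleftrightarrow>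
       (\<exists>\<omega>. ellipticity_rate \<omega> \<and>
         (\<forall>\<^sub>F a in nhds (-1).
           form_elliptic (\<Gamma> ` D) (boundary_norm D h \<Gamma>)
             (dtn_form D h \<Gamma> (complex_of_real a)) 1 (\<omega> a)))) \<and>
     (elliptically_regular D h \<Gamma> \<longleftrightarrow>
       (\<exists>\<omega> :: complex \<Rightarrow> real. ellipticity_rate (\<lambda>a. \<omega> (complex_of_real a)) \<and>
         (\<forall>z. z \<notin> dirichlet_spectrum D h \<Gamma> \<longrightarrow>
           form_elliptic (\<Gamma> ` D) (boundary_norm D h \<Gamma>) (dtn_form D h \<Gamma> z) 1 (\<omega> z)))) \<and>
     \<comment> \<open>(i) iff (vi)\<close>
     (elliptically_regular D h \<Gamma> \<longleftrightarrow> \<Gamma> ` neumann_dom D h \<subseteq> dtn_op_dom D h \<Gamma>) \<and>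
     \<comment> \<open>(i) iff (vii)\<close>
     (elliptically_regular D h \<Gamma> \<longleftrightarrow>
       (\<forall>u. \<Gamma> (neumann_resolvent D h u) \<in> dtn_op_dom D h \<Gamma>) \<and>
       bounded_op (\<lambda>u. dtn_op D h \<Gamma> (\<Gamma> (neumann_resolvent D h u))))"
proof -
  interpret boundary_pair_of_form D h \<Gamma>
    using assms by unfold_locales
  note iff = elliptically_regular_iff_at and m = dirichlet.minus_one_resolvent(2)
  have nonreal: "z \<in> \<rho>" if "z \<notin> \<real>" for z using dirichlet.nonreal_resolvent[OF that] .
  have Im_bounded: "form_bounded_on G (Im_form (dtn z)) \<longleftrightarrow> bounded_solution_map z" if z: "z \<notin> \<real>" for z
  proof (rule form_bounded_on_scaled_solution_form)
    show "- complex_of_real (Im z) \<noteq> 0" using z by (simp add: complex_is_Real_iff)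
  qed (rule Im_form_dtn_form[OF nonreal[OF z]])
  have deriv_bounded: "form_bounded_on G (dtn_form_deriv D h \<Gamma> r) \<longleftrightarrow> bounded_solution_map (complex_of_real r)"
    if "complex_of_real r \<in> \<rho>" for r
    by (rule form_bounded_on_scaled_solution_form[of "- 1"]) (simp_all add: dtn_form_deriv_eq[OF that])
  \<comment> \<open>The points \<open>\<i>\<close> and -1 show that the "any" versions of (iii) and
    (iv) are not vacuous, so they imply the "some" versions.\<close>
  have \<i>: "\<i> \<notin> \<real>" by (simp add: complex_is_Real_iff)
  have m': "complex_of_real (- 1) \<in> \<rho>" using m by simp
  have "elliptically_regular D h \<Gamma> \<longleftrightarrow>
      (\<exists>z. z \<notin> dirichlet_spectrum D h \<Gamma> \<and> solution_form_extends D h \<Gamma> z)"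
    unfolding mem_resolvent_iff using iff solution_form_extends_iff m by blast
  moreover have "elliptically_regular D h \<Gamma> \<longleftrightarrow>
      (\<forall>z. z \<notin> dirichlet_spectrum D h \<Gamma> \<longrightarrow> solution_form_extends D h \<Gamma> z)"
    unfolding mem_resolvent_iff using iff solution_form_extends_iff m by blast
  moreover have "elliptically_regular D h \<Gamma> \<longleftrightarrow>
      (\<exists>z. z \<notin> \<real> \<and> form_bounded_on G (Im_form (dtn z)))"
    using iff Im_bounded nonreal \<i> by metis
  moreover have "elliptically_regular D h \<Gamma> \<longleftrightarrow>
      (\<forall>z. z \<notin> \<real> \<longrightarrow> form_bounded_on G (Im_form (dtn z)))"
    using iff Im_bounded nonreal \<i> by metis
  moreover have "\<forall>z. z \<notin> \<real> \<longrightarrow> (\<forall>\<phi>\<in>G. \<forall>\<psi>\<in>G.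
      Im_form (dtn z) \<phi> \<psi> = - complex_of_real (Im z) * solution_form D h \<Gamma> z \<phi> \<psi>)"
    using Im_form_dtn_form nonreal by blast
  moreover have "\<forall>z. z \<notin> \<real> \<and> form_bounded_on G (Im_form (dtn z)) \<longrightarrow>
      form_assoc_bounded_op G (Im_form (dtn z))
        (\<lambda>\<phi>. (- complex_of_real (Im z)) *\<^sub>C solution_form_op D h \<Gamma> z \<phi>)"
  proof (intro allI impI, elim conjE)
    fix z assume z: "z \<notin> \<real>" and "form_bounded_on G (Im_form (dtn z))"
    then have "bounded_solution_map z" using Im_bounded by blast
    then show "form_assoc_bounded_op G (Im_form (dtn z))
        (\<lambda>\<phi>. (- complex_of_real (Im z)) *\<^sub>C solution_form_op D h \<Gamma> z \<phi>)"
      by (rule scaled_solution_form_op[OF nonreal[OF z]]) (rule Im_form_dtn_form[OF nonreal[OF z]])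
  qed
  moreover have "elliptically_regular D h \<Gamma> \<longleftrightarrow>
      (\<exists>r. complex_of_real r \<notin> dirichlet_spectrum D h \<Gamma> \<and> form_bounded_on G (dtn_form_deriv D h \<Gamma> r))"
    unfolding mem_resolvent_iff using iff deriv_bounded m' by metis
  moreover have "elliptically_regular D h \<Gamma> \<longleftrightarrow>
      (\<forall>r. complex_of_real r \<notin> dirichlet_spectrum D h \<Gamma> \<longrightarrow> form_bounded_on G (dtn_form_deriv D h \<Gamma> r))"
    unfolding mem_resolvent_iff using iff deriv_bounded m' by metis
  moreover have "\<forall>r. complex_of_real r \<notin> dirichlet_spectrum D h \<Gamma> \<and>
      form_bounded_on G (dtn_form_deriv D h \<Gamma> r) \<longrightarrow>
      form_assoc_bounded_op G (dtn_form_deriv D h \<Gamma> r)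
        (\<lambda>\<phi>. - solution_form_op D h \<Gamma> (complex_of_real r) \<phi>)"
  proof (intro allI impI, elim conjE)
    fix r assume "complex_of_real r \<notin> dirichlet_spectrum D h \<Gamma>"
      and b: "form_bounded_on G (dtn_form_deriv D h \<Gamma> r)"
    then have r: "complex_of_real r \<in> \<rho>" by (simp add: mem_resolvent_iff)
    then have "bounded_solution_map (complex_of_real r)" using b deriv_bounded by blast
    from scaled_solution_form_op[OF r this, of "dtn_form_deriv D h \<Gamma> r" "- 1"]
    show "form_assoc_bounded_op G (dtn_form_deriv D h \<Gamma> r)
        (\<lambda>\<phi>. - solution_form_op D h \<Gamma> (complex_of_real r) \<phi>)"
      by (simp add: dtn_form_deriv_eq[OF r] scaleC_minus_one)
  qed
  \<comment> \<open>Condition (v) is closed as a cycle: regularity gives the global version, that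
    gives the local one by restriction to real parameters, and the local one gives
    regularity.\<close>
  moreover have global: "\<exists>\<omega> :: complex \<Rightarrow> real. ellipticity_rate (\<lambda>a. \<omega> (complex_of_real a)) \<and>
      (\<forall>z. z \<notin> dirichlet_spectrum D h \<Gamma> \<longrightarrow>
        form_elliptic G (boundary_norm D h \<Gamma>) (dtn z) 1 (\<omega> z))"
    if "elliptically_regular D h \<Gamma>"
    using that ex_elliptic_constant unfolding elliptically_regular_iff mem_resolvent_iff by metis
  moreover have local: "\<exists>\<omega>. ellipticity_rate \<omega> \<and> (\<forall>\<^sub>F a in nhds (- 1).
      form_elliptic G (boundary_norm D h \<Gamma>) (dtn (complex_of_real a)) 1 (\<omega> a))"
    if glob: "\<exists>\<omega> :: complex \<Rightarrow> real. ellipticity_rate (\<lambda>a. \<omega> (complex_of_real a)) \<and>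
      (\<forall>z. z \<notin> dirichlet_spectrum D h \<Gamma> \<longrightarrow>
        form_elliptic G (boundary_norm D h \<Gamma>) (dtn z) 1 (\<omega> z))"
  proof -
    obtain \<omega> :: "complex \<Rightarrow> real" where rate: "ellipticity_rate (\<lambda>a. \<omega> (complex_of_real a))"
        and ell: "\<And>z. z \<in> \<rho> \<Longrightarrow> form_elliptic G (boundary_norm D h \<Gamma>) (dtn z) 1 (\<omega> z)"
      using glob unfolding mem_resolvent_iff by blast
    have "\<forall>\<^sub>F a in nhds (- 1).
        form_elliptic G (boundary_norm D h \<Gamma>) (dtn (complex_of_real a)) 1 (\<omega> (complex_of_real a))"
      by (rule eventually_mono[OF eventually_real_resolvent ell])
    then show ?thesis using rate by (intro exI[of _ "\<lambda>a. \<omega> (complex_of_real a)"]) simp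
  qed
  moreover have "elliptically_regular D h \<Gamma>"
    if "\<exists>\<omega>. ellipticity_rate \<omega> \<and> (\<forall>\<^sub>F a in nhds (- 1).
      form_elliptic G (boundary_norm D h \<Gamma>) (dtn (complex_of_real a)) 1 (\<omega> a))"
    using that bounded_solution_map_if_elliptic unfolding elliptically_regular_iff by blast
  moreover have "elliptically_regular D h \<Gamma> \<longleftrightarrow> \<Gamma> ` neumann_dom D h \<subseteq> dtn_op_dom D h \<Gamma>"
    unfolding elliptically_regular_iff neumann_dom_eq_range
    using dtn_op_trace_resolvent(1) bounded_solution_map_if_trace_in_dtn_dom by blast
  moreover have "elliptically_regular D h \<Gamma> \<longleftrightarrow>
      (\<forall>u. \<Gamma> (R u) \<in> dtn_op_dom D h \<Gamma>) \<and> bounded_op (\<lambda>u. dtn_op D h \<Gamma> (\<Gamma> (R u)))"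
    unfolding elliptically_regular_iff
    using dtn_op_trace_resolvent bounded_solution_map_if_trace_in_dtn_dom by blast
  ultimately show ?thesis by meson
qed

end
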